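(* Let $\Phi$ be a non-autonomous finite conformal iterated function system satisfying the open set condition, and let $E\subset\mathbb{R}^d$ be its non-autonomous finite conformal set. Suppose that $$\lim_{k\to+\infty}\frac{\log \underline c_k}{\log M_k}=0 .$$ Then for every $\theta\in[0,1]$ the upper and lower $\theta$-intermediate dimensions of $E$ are $$\overline{\dim}_\theta E=s^\theta,\qquad \underline{\dim}_\theta E=s_\theta .$$
   Context: Words. $\{I_k\}_{k\ge 1}$ is a sequence of index sets with $2\le \#I_k<\infty$. For $k\ge l\ge 1$, $\Sigma_l^k=\{u_l\cdots u_k: u_j\in I_j\}$; $\Sigma^k=\Sigma_1^k$, $\Sigma^0=\{\emptyset\}$, $\Sigma^*=\bigcup_{k\ge 0}\Sigma^k$, and $\Sigma^\infty=\{u_1u_2\cdots: u_k\in I_k\}$. $|\mathbf u|$ is the length of a word $\mathbf u$; for $\mathbf u=u_1\cdots u_k$, $\mathbf u^*=u_1\cdots u_{k-1}$. For $\mathbf u\in\Sigma^*$, $\mathcal C_{\mathbf u}$ is the set of $\mathbf v\in\Sigma^\infty$ having $\mathbf u$ as a prefix. A set $A\subset\Sigma^*$ is a cut set if $\Sigma^\infty\subset\bigcup_{\mathbf u\in A}\mathcal C_{\mathbf u}$ and $\mathcal C_{\mathbf u}\cap\mathcal C_{\mathbf v}=\emptyset$ for distinct $\mathbf u,\mathbf v\in A$. System. $J\subset\mathbb R^d$ is compact with non-empty interior and $\overline{\mathrm{int}(J)}=J$. For each $k\ge1$, $\Phi_k=\{\varphi_{k,i}\}_{i\in I_k}$ is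 a family of maps $\varphi_{k,i}:J\to J$. For $\mathbf u=u_l\cdots u_k\in\Sigma_l^k$, $\varphi_{\mathbf u}=\varphi_{l,u_l}\circ\cdots\circ\varphi_{k,u_k}$ (and $\varphi_\emptyset=\mathrm{id}$). $\Phi=\{\Phi_k\}_{k\ge1}$, together with a family $\{J_{\mathbf u}:\mathbf u\in\Sigma^*\}$ of closed subsets of $J$, is a non-autonomous finite iterated function system if: (i) there is $0<c<1$ with $|\varphi_{k,i}(x)-\varphi_{k,i}(y)|\le c|x-y|$ for all $k$, $i\in I_k$, $x,y\in J$; (ii) $J_\emptyset=J$ and $J_{\mathbf u i}\subset J_{\mathbf u}$ for all $\mathbf u\in\Sigma^{k-1}$, $i\in I_k$, $k\ge1$; (iii) for each $\mathbf u\in\Sigma^*$ there is $\omega_{\mathbf u}\in\mathbb R^d$ such that $J_{\mathbf u}=\Psi_{\mathbf u}(J)$ with $\Psi_{\mathbf u}=\varphi_{\mathbf u}+\omega_{\mathbf u}$. Its attractor is $E=\bigcap_{k\ge1}\bigcup_{\mathbf u\in\Sigma^k}J_{\mathbf u}$. The open set condition (OSC) means: for all $k\ge0$, $\mathbf u\in\Sigma^k$ and $i\ne j\in I_{k+1}$, $\mathrm{int}(J_{\mathbf ui})\cap\mathrm{int}(J_{\mathbf uj})=\emptyset$. Conformality. $\Phi$ is conformal (and $E$ is called a non-autonomous finite conformal set) if there is an open connected set $V\supset J$, independent of $k$, such that each $\varphi_{k,j}$ extends to a $C^1$ conformal diffeomorphism of $V$ into $V$ (the derivative at each point is a similarity linear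 map), and there is $C\ge1$ with $\|D\varphi_{\mathbf u}(x)\|\le C\|D\varphi_{\mathbf u}(y)\|$ for all $x,y\in V$ and all $\mathbf u\in\Sigma_l^k$, $k\ge l\ge1$. Here $\|D\varphi(x)\|$ is the scaling factor of $D\varphi(x)$ and $\|D\varphi\|=\sup_{x\in J}\|D\varphi(x)\|$. Put $M_k=\sup_{\mathbf u\in\Sigma^k}\|D\varphi_{\mathbf u}\|$ and $\underline c_k=\inf_{j\in I_k}\|D\varphi_{k,j}\|$. Pressures. For $\delta>0$ and $\theta\in(0,1]$, $\mathcal M(\delta,\theta)$ is the collection of cut sets $\mathcal M$ such that $\delta^{1/\theta}<\|D\varphi_{\mathbf u^*}\|$ and $\|D\varphi_{\mathbf u}\|\le\delta$ for each $\mathbf u\in\mathcal M$; $k_\delta=\min\{|\mathbf u|:\mathbf u\in\Sigma^*,\ \|D\varphi_{\mathbf u}\|\le\delta<\|D\varphi_{\mathbf u^*}\|\}$. Define $$\overline P(t,\theta)=\limsup_{\delta\to0}\frac1{k_\delta}\log\min_{\mathcal M\in\mathcal M(\delta,\theta)}\sum_{\mathbf u\in\mathcal M}\|D\varphi_{\mathbf u}\|^t,\qquad \underline P(t,\theta)=\liminf_{\delta\to0}\frac1{k_\delta}\log\min_{\mathcal M\in\mathcal M(\delta,\theta)}\sum_{\mathbf u\in\mathcal M}\|D\varphi_{\mathbf u}\|^t,$$ and, for $\theta\in(0,1]$, $s^\theta=\inf\{t:\overline P(t,\theta)<0\}=\sup\{t:\overline P(t,\theta)>0\}$ and $s_\theta=\inf\{t:\underline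 P(t,\theta)<0\}=\sup\{t:\underline P(t,\theta)>0\}$. For $\theta=0$ one sets by convention $s_0=s^0=\dim_{\rm H}E$ (Hausdorff dimension). Intermediate dimensions. With $|U|$ the diameter of $U$, for $0\le\theta\le1$: $\underline{\dim}_\theta E$ is the infimum of $s\ge0$ such that for all $\varepsilon>0$, $\Delta>0$ there exist $0<\delta\le\Delta$ and a cover $\{U_i\}$ of $E$ with $\delta^{1/\theta}\le|U_i|\le\delta$ and $\sum|U_i|^s\le\varepsilon$; $\overline{\dim}_\theta E$ is the infimum of $s\ge0$ such that for all $\varepsilon>0$ there is $\Delta>0$ such that for all $0<\delta\le\Delta$ there is a cover $\{U_i\}$ of $E$ with $\delta^{1/\theta}\le|U_i|\le\delta$ and $\sum|U_i|^s\le\varepsilon$. For $\theta=0$ there is no lower restriction on $|U_i|$ and both quantities equal $\dim_{\rm H}E$. *)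

theory Defs
  imports "HOL-Analysis.Analysis"
begin

section \<open>Words and cut sets\<close>

text \<open>A word \<open>u\<^sub>l \<dots> u\<^sub>k\<close> is the list of its letters, so the letter \<open>u\<^sub>j\<close> is the list entry with
  index \<open>j - l\<close>.  The index sets \<open>I k\<close> are used for \<open>k \<ge> 1\<close> only.  An infinite word
  \<open>u\<^sub>1 u\<^sub>2 \<dots>\<close> is the function sending \<open>j\<close> to \<open>u\<^bsub>j+1\<^esub>\<close>.\<close>

definition words_from :: "(nat \<Rightarrow> 'i set) \<Rightarrow> nat \<Rightarrow> nat \<Rightarrow> 'i list set" where
  "words_from I l k = {w. length w = Suc k - l \<and> (\<forall>j<length w. w ! j \<in> I (l + j))}"

definition words :: "(nat \<Rightarrow> 'i set) \<Rightarrow> nat \<Rightarrow> 'i list set" where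
  "words I k = words_from I 1 k"

definition all_words :: "(nat \<Rightarrow> 'i set) \<Rightarrow> 'i list set" where
  "all_words I = (\<Union>k. words I k)"

definition infinite_words :: "(nat \<Rightarrow> 'i set) \<Rightarrow> (nat \<Rightarrow> 'i) set" where
  "infinite_words I = {v. \<forall>j. v j \<in> I (Suc j)}"

definition cylinder :: "(nat \<Rightarrow> 'i set) \<Rightarrow> 'i list \<Rightarrow> (nat \<Rightarrow> 'i) set" where
  "cylinder I u = {v \<in> infinite_words I. \<forall>j<length u. v j = u ! j}"

definition cut_set :: "(nat \<Rightarrow> 'i set) \<Rightarrow> 'i list set \<Rightarrow> bool" where
  "cut_set I A \<longleftrightarrow>
     A \<subseteq> all_words I \<and>
     infinite_words I \<subseteq> (\<Union>u\<in>A. cylinder I u) \<and>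
     (\<forall>u\<in>A. \<forall>v\<in>A. u \<noteq> v \<longrightarrow> cylinder I u \<inter> cylinder I v = {})"

section \<open>Non-autonomous iterated function systems\<close>

text \<open>\<open>word_map \<phi> l u\<close> is \<open>\<phi>\<^sub>u\<close> for a word \<open>u\<close> whose first letter belongs to level \<open>l\<close>.\<close>

primrec word_map :: "(nat \<Rightarrow> 'i \<Rightarrow> 'a \<Rightarrow> 'a) \<Rightarrow> nat \<Rightarrow> 'i list \<Rightarrow> 'a \<Rightarrow> 'a" where
  "word_map \<phi> l [] = id"
| "word_map \<phi> l (i # w) = \<phi> l i \<circ> word_map \<phi> (Suc l) w"

definition nonautonomous_ifs ::
  "(nat \<Rightarrow> 'i set) \<Rightarrow> 'a::euclidean_space set \<Rightarrow> (nat \<Rightarrow> 'i \<Rightarrow> 'a \<Rightarrow> 'a) \<Rightarrow> ('i list \<Rightarrow> 'a set) \<Rightarrow> bool"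
where
  "nonautonomous_ifs I J \<phi> Jw \<longleftrightarrow>
     (\<forall>k\<ge>1. finite (I k) \<and> 2 \<le> card (I k)) \<and>
     compact J \<and> interior J \<noteq> {} \<and> closure (interior J) = J \<and>
     (\<forall>k\<ge>1. \<forall>i\<in>I k. \<phi> k i ` J \<subseteq> J) \<and>
     (\<forall>u\<in>all_words I. closed (Jw u) \<and> Jw u \<subseteq> J) \<and>
     (\<exists>c. 0 < c \<and> c < 1 \<and>
        (\<forall>k\<ge>1. \<forall>i\<in>I k. \<forall>x\<in>J. \<forall>y\<in>J. norm (\<phi> k i x - \<phi> k i y) \<le> c * norm (x - y))) \<and>
     Jw [] = J \<and>
     (\<forall>k\<ge>1. \<forall>u\<in>words I (k - 1). \<forall>i\<in>I k. Jw (u @ [i]) \<subseteq> Jw u) \<and>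
     (\<forall>u\<in>all_words I. \<exists>\<omega>. Jw u = (\<lambda>x. word_map \<phi> 1 u x + \<omega>) ` J)"

definition attractor :: "(nat \<Rightarrow> 'i set) \<Rightarrow> ('i list \<Rightarrow> 'a set) \<Rightarrow> 'a set" where
  "attractor I Jw = (\<Inter>k\<in>{1..}. \<Union>u\<in>words I k. Jw u)"

definition open_set_condition ::
  "(nat \<Rightarrow> 'i set) \<Rightarrow> ('i list \<Rightarrow> 'a::topological_space set) \<Rightarrow> bool" where
  "open_set_condition I Jw \<longleftrightarrow>
     (\<forall>k. \<forall>u\<in>words I k. \<forall>i\<in>I (k + 1). \<forall>j\<in>I (k + 1).
        i \<noteq> j \<longrightarrow> interior (Jw (u @ [i])) \<inter> interior (Jw (u @ [j])) = {})"

section \<open>Conformality\<close>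

definition similarity_linear :: "('a::euclidean_space \<Rightarrow> 'a) \<Rightarrow> bool" where
  "similarity_linear L \<longleftrightarrow> linear L \<and> (\<exists>r>0. \<forall>h. norm (L h) = r * norm h)"

text \<open>The scaling factor of the derivative of \<open>f\<close> at \<open>x\<close>; meaningful only where that
  derivative is a similarity.\<close>

definition scaling_factor :: "('a::euclidean_space \<Rightarrow> 'a) \<Rightarrow> 'a \<Rightarrow> real" where
  "scaling_factor f x = (THE r. \<forall>h. norm (frechet_derivative f (at x) h) = r * norm h)"

definition C1_on :: "'a::euclidean_space set \<Rightarrow> ('a \<Rightarrow> 'a) \<Rightarrow> bool" where
  "C1_on S f \<longleftrightarrow>
     (\<exists>D. (\<forall>x\<in>S. (f has_derivative blinfun_apply (D x)) (at x)) \<and> continuous_on S D)"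

definition conformal_diffeo_into :: "'a::euclidean_space set \<Rightarrow> ('a \<Rightarrow> 'a) \<Rightarrow> bool" where
  "conformal_diffeo_into V f \<longleftrightarrow>
     f ` V \<subseteq> V \<and> open (f ` V) \<and> inj_on f V \<and>
     C1_on V f \<and> C1_on (f ` V) (inv_into V f) \<and>
     (\<forall>x\<in>V. similarity_linear (frechet_derivative f (at x)))"

text \<open>\<open>\<psi> k i\<close> is the extension of \<open>\<phi> k i\<close> from \<open>J\<close> to \<open>V\<close>; the system is conformal iff such
  \<open>V\<close> and \<open>\<psi>\<close> exist.  All derivatives below are those of \<open>\<psi>\<close>.  Their scaling factors on \<open>J\<close> do
  not depend on the choice of the extension: \<open>\<phi>\<close> determines them on the interior of \<open>J\<close>, hence
  by continuity on \<open>J = closure (interior J)\<close>.\<close>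

definition conformal_extension ::
  "(nat \<Rightarrow> 'i set) \<Rightarrow> 'a::euclidean_space set \<Rightarrow> (nat \<Rightarrow> 'i \<Rightarrow> 'a \<Rightarrow> 'a) \<Rightarrow>
   'a set \<Rightarrow> (nat \<Rightarrow> 'i \<Rightarrow> 'a \<Rightarrow> 'a) \<Rightarrow> bool"
where
  "conformal_extension I J \<phi> V \<psi> \<longleftrightarrow>
     open V \<and> connected V \<and> J \<subseteq> V \<and>
     (\<forall>k\<ge>1. \<forall>i\<in>I k. (\<forall>x\<in>J. \<psi> k i x = \<phi> k i x) \<and> conformal_diffeo_into V (\<psi> k i)) \<and>
     (\<exists>C\<ge>1. \<forall>l\<ge>1. \<forall>k\<ge>l. \<forall>u\<in>words_from I l k. \<forall>x\<in>V. \<forall>y\<in>V.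
        scaling_factor (word_map \<psi> l u) x \<le> C * scaling_factor (word_map \<psi> l u) y)"

definition deriv_norm :: "'a::euclidean_space set \<Rightarrow> ('a \<Rightarrow> 'a) \<Rightarrow> real" where
  "deriv_norm J f = (SUP x\<in>J. scaling_factor f x)"

definition word_norm ::
  "'a::euclidean_space set \<Rightarrow> (nat \<Rightarrow> 'i \<Rightarrow> 'a \<Rightarrow> 'a) \<Rightarrow> 'i list \<Rightarrow> real" where
  "word_norm J \<psi> u = deriv_norm J (word_map \<psi> 1 u)"

definition max_norm ::
  "(nat \<Rightarrow> 'i set) \<Rightarrow> 'a::euclidean_space set \<Rightarrow> (nat \<Rightarrow> 'i \<Rightarrow> 'a \<Rightarrow> 'a) \<Rightarrow> nat \<Rightarrow> real" where
  "max_norm I J \<psi> k = (SUP u\<in>words I k. word_norm J \<psi> u)"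

definition min_ratio ::
  "(nat \<Rightarrow> 'i set) \<Rightarrow> 'a::euclidean_space set \<Rightarrow> (nat \<Rightarrow> 'i \<Rightarrow> 'a \<Rightarrow> 'a) \<Rightarrow> nat \<Rightarrow> real" where
  "min_ratio I J \<psi> k = (INF j\<in>I k. deriv_norm J (\<psi> k j))"

section \<open>Pressures\<close>

text \<open>\<open>butlast u\<close> is the word \<open>u\<close> without its last letter.  Since \<open>butlast [] = []\<close> and the empty
  word has norm 1, the empty word satisfies neither of the next two conditions when
  \<open>\<delta> < 1\<close>.\<close>

definition cut_sets ::
  "(nat \<Rightarrow> 'i set) \<Rightarrow> 'a::euclidean_space set \<Rightarrow> (nat \<Rightarrow> 'i \<Rightarrow> 'a \<Rightarrow> 'a) \<Rightarrow>
   real \<Rightarrow> real \<Rightarrow> 'i list set set"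
where
  "cut_sets I J \<psi> \<delta> \<theta> =
     {A. cut_set I A \<and>
         (\<forall>u\<in>A. \<delta> powr (1 / \<theta>) < word_norm J \<psi> (butlast u) \<and> word_norm J \<psi> u \<le> \<delta>)}"

definition k_delta ::
  "(nat \<Rightarrow> 'i set) \<Rightarrow> 'a::euclidean_space set \<Rightarrow> (nat \<Rightarrow> 'i \<Rightarrow> 'a \<Rightarrow> 'a) \<Rightarrow> real \<Rightarrow> nat"
where
  "k_delta I J \<psi> \<delta> =
     (LEAST n. \<exists>u\<in>all_words I. n = length u \<and>
        word_norm J \<psi> u \<le> \<delta> \<and> \<delta> < word_norm J \<psi> (butlast u))"

text \<open>A cut set is finite (its cylinders partition a compact product space into nonempty open
  sets), so the finite sum is the intended one.  For \<open>0 < \<delta> < 1\<close> the collection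
  \<open>cut_sets I J \<psi> \<delta> \<theta>\<close> is finite and nonempty, so the infimum over it is a minimum.\<close>

definition pressure_term ::
  "(nat \<Rightarrow> 'i set) \<Rightarrow> 'a::euclidean_space set \<Rightarrow> (nat \<Rightarrow> 'i \<Rightarrow> 'a \<Rightarrow> 'a) \<Rightarrow>
   real \<Rightarrow> real \<Rightarrow> real \<Rightarrow> real"
where
  "pressure_term I J \<psi> t \<theta> \<delta> =
     1 / real (k_delta I J \<psi> \<delta>) *
       ln (INF A\<in>cut_sets I J \<psi> \<delta> \<theta>. \<Sum>u\<in>A. word_norm J \<psi> u powr t)"

definition upper_pressure ::
  "(nat \<Rightarrow> 'i set) \<Rightarrow> 'a::euclidean_space set \<Rightarrow> (nat \<Rightarrow> 'i \<Rightarrow> 'a \<Rightarrow> 'a) \<Rightarrow> real \<Rightarrow> real \<Rightarrow> ereal"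
where
  "upper_pressure I J \<psi> t \<theta> = Limsup (at_right 0) (\<lambda>\<delta>. ereal (pressure_term I J \<psi> t \<theta> \<delta>))"

definition lower_pressure ::
  "(nat \<Rightarrow> 'i set) \<Rightarrow> 'a::euclidean_space set \<Rightarrow> (nat \<Rightarrow> 'i \<Rightarrow> 'a \<Rightarrow> 'a) \<Rightarrow> real \<Rightarrow> real \<Rightarrow> ereal"
where
  "lower_pressure I J \<psi> t \<theta> = Liminf (at_right 0) (\<lambda>\<delta>. ereal (pressure_term I J \<psi> t \<theta> \<delta>))"

section \<open>Hausdorff and intermediate dimensions\<close>

text \<open>\<open>diam_powr s U\<close> is \<open>|U|\<^sup>s\<close> for bounded \<open>U\<close>.  Isabelle has \<open>0 powr 0 = 0\<close>, whereas the
  convention here is \<open>|U|\<^sup>0 = 1\<close> for nonempty \<open>U\<close>.  The library function \<open>diameter\<close> carries no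
  information for unbounded sets, hence the boundedness clause in \<open>countable_cover\<close>.\<close>

definition diam_powr :: "real \<Rightarrow> 'a::metric_space set \<Rightarrow> ennreal" where
  "diam_powr s U =
     (if U = {} then 0 else if s = 0 then 1 else ennreal (diameter U powr s))"

definition countable_cover :: "'a::metric_space set \<Rightarrow> real \<Rightarrow> 'a set set \<Rightarrow> bool" where
  "countable_cover E \<delta> \<U> \<longleftrightarrow>
     countable \<U> \<and> E \<subseteq> \<Union>\<U> \<and> (\<forall>U\<in>\<U>. bounded U \<and> diameter U \<le> \<delta>)"

definition hausdorff_premeasure :: "real \<Rightarrow> real \<Rightarrow> 'a::metric_space set \<Rightarrow> ennreal" where
  "hausdorff_premeasure s \<delta> E =
     (INF \<U>\<in>{\<U>. countable_cover E \<delta> \<U>}. \<Sum>\<^sub>\<infinity>U\<in>\<U>. diam_powr s U)"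

definition hausdorff_measure :: "real \<Rightarrow> 'a::metric_space set \<Rightarrow> ennreal" where
  "hausdorff_measure s E = (SUP \<delta>\<in>{0<..}. hausdorff_premeasure s \<delta> E)"

definition hausdorff_dim :: "'a::euclidean_space set \<Rightarrow> real" where
  "hausdorff_dim E = Inf {s. 0 \<le> s \<and> hausdorff_measure s E = 0}"

text \<open>Covers are sets of sets rather than sequences, so that finite covers are allowed: for
  \<open>\<theta> > 0\<close> the lower bound on the diameters forces covers of finite cost to be finite.\<close>

definition admissible_cover ::
  "'a::metric_space set \<Rightarrow> real \<Rightarrow> real \<Rightarrow> 'a set set \<Rightarrow> bool" where
  "admissible_cover E \<theta> \<delta> \<U> \<longleftrightarrow>
     countable_cover E \<delta> \<U> \<and> (\<theta> > 0 \<longrightarrow> (\<forall>U\<in>\<U>. \<delta> powr (1 / \<theta>) \<le> diameter U))"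

definition lower_intermediate_dim :: "real \<Rightarrow> 'a::euclidean_space set \<Rightarrow> real" where
  "lower_intermediate_dim \<theta> E =
     Inf {s. 0 \<le> s \<and>
       (\<forall>\<epsilon>>0. \<forall>\<Delta>>0. \<exists>\<delta>. 0 < \<delta> \<and> \<delta> \<le> \<Delta> \<and>
          (\<exists>\<U>. admissible_cover E \<theta> \<delta> \<U> \<and> (\<Sum>\<^sub>\<infinity>U\<in>\<U>. diam_powr s U) \<le> ennreal \<epsilon>))}"

definition upper_intermediate_dim :: "real \<Rightarrow> 'a::euclidean_space set \<Rightarrow> real" where
  "upper_intermediate_dim \<theta> E =
     Inf {s. 0 \<le> s \<and>
       (\<forall>\<epsilon>>0. \<exists>\<Delta>>0. \<forall>\<delta>. 0 < \<delta> \<and> \<delta> \<le> \<Delta> \<longrightarrow>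
          (\<exists>\<U>. admissible_cover E \<theta> \<delta> \<U> \<and> (\<Sum>\<^sub>\<infinity>U\<in>\<U>. diam_powr s U) \<le> ennreal \<epsilon>))}"

section \<open>Critical exponents\<close>

text \<open>Under the open set condition the sets of \<open>t\<close> below are nonempty and bounded below by 0, so the
  real infimum is the intended one.  As the pressures decrease by at least
  \<open>\<epsilon> * ln (1 / c)\<close> when \<open>t\<close> grows by \<open>\<epsilon>\<close>, where \<open>c\<close> is the contraction constant, the infimum
  also equals \<open>sup {t. P t > 0}\<close>.\<close>

definition upper_exponent ::
  "(nat \<Rightarrow> 'i set) \<Rightarrow> 'a::euclidean_space set \<Rightarrow> (nat \<Rightarrow> 'i \<Rightarrow> 'a \<Rightarrow> 'a) \<Rightarrow> ('i list \<Rightarrow> 'a set) \<Rightarrow>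
   real \<Rightarrow> real"
where
  "upper_exponent I J \<psi> Jw \<theta> =
     (if \<theta> = 0 then hausdorff_dim (attractor I Jw) else Inf {t. upper_pressure I J \<psi> t \<theta> < 0})"

definition lower_exponent ::
  "(nat \<Rightarrow> 'i set) \<Rightarrow> 'a::euclidean_space set \<Rightarrow> (nat \<Rightarrow> 'i \<Rightarrow> 'a \<Rightarrow> 'a) \<Rightarrow> ('i list \<Rightarrow> 'a set) \<Rightarrow>
   real \<Rightarrow> real"
where
  "lower_exponent I J \<psi> Jw \<theta> =
     (if \<theta> = 0 then hausdorff_dim (attractor I Jw) else Inf {t. lower_pressure I J \<psi> t \<theta> < 0})"

end

theory Submission
  imports Defs
begin

text \<open>For a word \<open>u\<close> write \<open>N u\<close> for the norm of the derivative of its composed map.  By bounded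
  distortion the basic set of \<open>u\<close> is, up to constants, as large as \<open>N u\<close>: its diameter is at
  most \<open>K * N u\<close> (\<open>Jw_dist_le\<close>) and it contains a ball of radius \<open>\<kappa> * N u\<close>
  (\<open>Jw_contains_ball\<close>).  By the open set condition, basic sets of words none of which is a
  prefix of another have disjoint interiors, so comparing volumes bounds how many large ones fit into
  a ball (\<open>sum_norm_power_le\<close>).

  The condition on the ratios says that appending one letter costs only a subexponential factor:
  for every \<open>\<gamma> > 1\<close>, \<open>N (butlast u) powr \<gamma> \<le> B * N u\<close> for all long words \<open>u\<close>
  (\<open>norm_butlast_powr_le\<close>).  Since every comparison of exponents leaves a gap between two reals
  \<open>s\<close> and \<open>t\<close>, this loss can always be absorbed, and covers and cut sets translate into each other:

  \<^item> The basic sets of a cut set with scale \<open>\<delta>\<close> cover the attractor.  Replacing each by a ball whose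
    diameter is at least the smallest permitted one gives an admissible cover at a scale
    proportional to \<open>\<delta>\<close>, of cost at most a constant times the sum over the cut set
    (\<open>cover_of_cut_set\<close>).
  \<^item> Conversely, in a cover of bounded cost every member \<open>X\<close> is replaced by the words that meet \<open>X\<close>
    and whose norm passes the diameter of \<open>X\<close>; the minimal ones among all these words form a cut
    set with the prescribed bounds, and by the volume estimate its sum with an exponent \<open>t > s\<close> is at
    most a constant times a positive power of \<open>\<delta>\<close> (\<open>cut_set_of_cover\<close>).

  A positive power of \<open>\<delta>\<close> decays exponentially in \<open>k_delta\<close>, because \<open>\<delta>\<close> is less than the norm of
  a word of length \<open>k_delta - 1\<close> (\<open>pressure_term_le\<close>).  Hence if the pressure is negative at \<open>t\<close> then
  every \<open>s > t\<close> admits cheap covers, and if \<open>s\<close> admits cheap covers then the pressure is negative at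
  every \<open>t > s\<close>; so the two infima agree (\<open>Inf_eq_of_interlacing\<close>).  The upper and lower versions
  differ only in whether the estimates hold for all small \<open>\<delta>\<close> or for arbitrarily small ones.  For
  \<open>\<theta> = 0\<close> both dimensions unfold to the Hausdorff dimension (\<open>intermediate_dim_0\<close>).\<close>

section \<open>Derivatives, images of balls and volume\<close>

lemma scaling_factor_eqI:
  fixes f :: "'a::euclidean_space \<Rightarrow> 'a"
  assumes "(f has_derivative L) (at x)" and "\<And>h. norm (L h) = r * norm h"
  shows "scaling_factor f x = r"
proof -
  have L: "frechet_derivative f (at x) = L"
    using frechet_derivative_at[OF assms(1)] by simp
  obtain e :: 'a where "e \<in> Basis" using nonempty_Basis by blast
  then have e: "norm e = 1" by simp
  show ?thesis unfolding scaling_factor_def L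
  proof (rule the_equality)
    show "\<forall>h. norm (L h) = r * norm h" using assms(2) by blast
  next
    fix r' assume "\<forall>h. norm (L h) = r' * norm h"
    then have "norm (L e) = r' * norm e" by blast
    then show "r' = r" using assms(2)[of e] e by simp
  qed
qed

text \<open>The contraction property of the maps holds on the set \<open>J\<close> only, so it controls derivatives
  directly just at interior points of \<open>J\<close>; bounded distortion carries it to all other points.\<close>

lemma norm_derivative_le_lipschitz:
  fixes f :: "'a::real_normed_vector \<Rightarrow> 'b::real_normed_vector"
  assumes der: "(f has_derivative L) (at x)" and x: "x \<in> interior S"
    and lip: "\<And>y. y \<in> S \<Longrightarrow> norm (f y - f x) \<le> K * norm (y - x)"
  shows "norm (L h) \<le> K * norm h"
proof (rule field_le_epsilon)
  fix e :: real assume e: "e > 0"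
  interpret L: bounded_linear L using der by (rule has_derivative_bounded_linear)
  show "norm (L h) \<le> K * norm h + e"
  proof (cases "h = 0")
    case True then show ?thesis using e by (simp add: L.zero)
  next
    case False
    then have h: "norm h > 0" by simp
    define a where "a = e / norm h"
    have a: "a > 0" "a * norm h = e" using e h by (auto simp: a_def)
    obtain d where d: "d > 0"
      "\<And>y. norm (y - x) < d \<Longrightarrow> norm (f y - f x - L (y - x)) \<le> a * norm (y - x)"
      using der a(1) unfolding has_derivative_at_alt by blast
    obtain r where r: "r > 0" "ball x r \<subseteq> S" using x unfolding mem_interior by blast
    \<comment> \<open>\<open>t\<close> is so small that \<open>x + t *\<^sub>R h\<close> lies both in \<open>S\<close> and in the range of the linear approximation.\<close>
    define t where "t = min d r / (2 * norm h)"
    have t: "t > 0" "t * norm h < d" "t * norm h < r"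
      using d(1) r(1) h by (auto simp: t_def min_def)
    define y where "y = x + t *\<^sub>R h"
    have ny: "norm (y - x) = t * norm h" using t(1) by (simp add: y_def)
    have "y \<in> S" using r(2) t(3) ny by (auto simp: dist_norm norm_minus_commute)
    then have 1: "norm (f y - f x) \<le> K * (t * norm h)" using lip ny by metis
    have 2: "norm (f y - f x - L (y - x)) \<le> a * (t * norm h)" using d(2) t(2) ny by metis
    have 3: "L (y - x) = t *\<^sub>R L h" by (simp add: y_def L.scaleR)
    have "t * norm (L h) = norm (L (y - x))" using 3 t(1) by simp
    also have "\<dots> \<le> norm (f y - f x) + norm (f y - f x - L (y - x))"
      using norm_triangle_ineq4[of "f y - f x" "f y - f x - L (y - x)"] by simp
    also have "\<dots> \<le> K * (t * norm h) + a * (t * norm h)" using 1 2 by linarith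
    also have "\<dots> = t * (K * norm h + e)" using a(2) by (simp add: algebra_simps)
    finally show ?thesis using t(1) by simp
  qed
qed

text \<open>Let \<open>R\<close> be the distance from \<open>f x0\<close> to the complement of the image.  On the convex ball of
  radius \<open>R\<close> the inverse is Lipschitz with constant \<open>1 / m\<close>.  If \<open>R < m * r\<close>, that ball therefore
  comes from a compact ball strictly inside the given one, so its closure still lies in the image,
  against the choice of \<open>R\<close>.  No convexity of the image is available, hence the detour through
  the largest ball.\<close>

lemma image_ball_contains_ball:
  fixes f :: "'a::euclidean_space \<Rightarrow> 'a"
  assumes r: "r > 0" and m: "m > 0" and inj: "inj_on f (ball x0 r)"
    and der: "\<And>x. x \<in> ball x0 r \<Longrightarrow> (f has_derivative D x) (at x)"
    and exp: "\<And>x h. x \<in> ball x0 r \<Longrightarrow> m * norm h \<le> norm (D x h)"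
  shows "ball (f x0) (m * r) \<subseteq> f ` ball x0 r"
proof (rule ccontr)
  assume no: "\<not> ?thesis"
  define W where "W = f ` ball x0 r"
  have cf: "continuous_on (ball x0 r) f"
    using der by (meson continuous_at_imp_continuous_on has_derivative_continuous)
  obtain g where hom: "homeomorphism (ball x0 r) W f g"
    using invariance_of_domain_homeomorphism[OF open_ball cf _ inj] unfolding W_def by auto
  have oW: "open W" unfolding W_def using invariance_of_domain[OF cf open_ball inj] .
  have x0W: "f x0 \<in> W" using r by (simp add: W_def)
  have cl: "closed (- W)" using oW by (simp add: closed_Compl)
  obtain p where "p \<in> ball (f x0) (m * r)" "p \<notin> W" using no unfolding W_def by blast
  then have p: "p \<in> - W" "dist (f x0) p < m * r" by auto
  \<comment> \<open>\<open>q\<close> is a point of the complement of the image nearest to \<open>f x0\<close>.\<close>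
  obtain q where q: "q \<in> - W" "\<And>z. z \<in> - W \<Longrightarrow> dist (f x0) q \<le> dist (f x0) z"
    using distance_attains_inf[OF cl, of "f x0"] p(1) by blast
  define R where "R = dist (f x0) q"
  have Rpos: "R > 0" using q(1) x0W by (auto simp: R_def)
  have Rr: "R < m * r" using q(2)[OF p(1)] p(2) by (simp add: R_def)
  have BW: "ball (f x0) R \<subseteq> W" using q(2) unfolding R_def by fastforce
  have gW: "g y \<in> ball x0 r" "f (g y) = y" if "y \<in> W" for y
    using hom that unfolding homeomorphism_def by auto
  have gf: "g (f x) = x" if "x \<in> ball x0 r" for x
    using hom that unfolding homeomorphism_def by auto
  have gder: "\<exists>G. (g has_derivative G) (at y) \<and> onorm G \<le> 1 / m" if y: "y \<in> W" for y
  proof -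
    have lin: "linear (D (g y))" using der[OF gW(1)[OF y]] by (rule has_derivative_linear)
    have injD: "inj (D (g y))"
    proof (subst linear_injective_0[OF lin], intro allI impI)
      fix h assume "D (g y) h = 0"
      then have "m * norm h \<le> 0" using exp[OF gW(1)[OF y], of h] by simp
      then show "h = 0" using m by (simp add: mult_le_0_iff)
    qed
    obtain G where G: "linear G" "G \<circ> D (g y) = id" 
      using linear_injective_left_inverse[OF lin injD] by blast
    have G2: "D (g y) \<circ> G = id" using linear_inverse_left[OF lin G(1)] G(2) by blast
    have "(g has_derivative G) (at y)"
    proof (rule has_derivative_inverse_basic[where f = f and f' = "D (g y)" and T = W])
      show "bounded_linear G" using G(1) by (simp add: linear_conv_bounded_linear)
      show "continuous (at y) g"
        using hom oW y by (simp add: homeomorphism_def continuous_on_eq_continuous_at)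
    qed (use gW der G(2) oW y in auto)
    moreover have "onorm G \<le> 1 / m"
    proof (rule onorm_le)
      fix z
      have "D (g y) (G z) = z" using G2 by (metis comp_apply id_apply)
      then show "norm (G z) \<le> 1 / m * norm z"
        using exp[OF gW(1)[OF y], of "G z"] m by (simp add: field_simps)
    qed
    ultimately show ?thesis by blast
  qed
  then obtain G where G: "\<And>y. y \<in> W \<Longrightarrow> (g has_derivative G y) (at y) \<and> onorm (G y) \<le> 1 / m"
    by metis
  have glip: "norm (g y - g (f x0)) \<le> 1 / m * norm (y - f x0)" if "y \<in> ball (f x0) R" for y
  proof (rule differentiable_bound[where S = "ball (f x0) R" and f' = G])
    show "\<And>x. x \<in> ball (f x0) R \<Longrightarrow> (g has_derivative G x) (at x within ball (f x0) R)"
      using G BW has_derivative_at_withinI by blast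
  qed (use G BW Rpos that in auto)
  have "R / m < r" using Rr m by (simp add: field_simps)
  then have sub: "cball x0 (R / m) \<subseteq> ball x0 r" by auto
  have comp: "compact (f ` cball x0 (R / m))"
    using continuous_on_subset[OF cf sub] by (rule compact_continuous_image) simp
  have "ball (f x0) R \<subseteq> f ` cball x0 (R / m)"
  proof
    fix y assume y: "y \<in> ball (f x0) R"
    have "norm (g y - x0) \<le> 1 / m * norm (y - f x0)" using glip[OF y] gf r by simp
    also have "\<dots> \<le> R / m"
      using y m by (simp add: dist_norm norm_minus_commute divide_right_mono)
    finally have "g y \<in> cball x0 (R / m)" by (simp add: dist_norm norm_minus_commute)
    moreover have "f (g y) = y" using gW(2) y BW by blast
    ultimately show "y \<in> f ` cball x0 (R / m)" by (metis imageI)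
  qed
  then have "closure (ball (f x0) R) \<subseteq> f ` cball x0 (R / m)"
    using comp by (simp add: closure_minimal compact_imp_closed)
  moreover have "q \<in> closure (ball (f x0) R)" using Rpos by (simp add: R_def)
  ultimately have "q \<in> W" using sub unfolding W_def by blast
  then show False using q(1) by simp
qed

text \<open>The volume of a ball is its radius to the power of the dimension, up to a common factor.\<close>

lemma sum_power_radii_le_of_disjoint_balls:
  fixes p :: "'b \<Rightarrow> 'a::euclidean_space"
  assumes fin: "finite A" and r: "\<And>u. u \<in> A \<Longrightarrow> 0 \<le> r u" and R: "R \<ge> 0"
    and disj: "\<And>u v. u \<in> A \<Longrightarrow> v \<in> A \<Longrightarrow> u \<noteq> v \<Longrightarrow> ball (p u) (r u) \<inter> ball (p v) (r v) = {}"
    and sub: "\<And>u. u \<in> A \<Longrightarrow> ball (p u) (r u) \<subseteq> cball x R"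
  shows "(\<Sum>u\<in>A. r u ^ DIM('a)) \<le> R ^ DIM('a)"
proof -
  define b where "b = measure lborel (ball (0::'a) 1)"
  have b: "b > 0" by (simp add: b_def)
  have "(\<Sum>u\<in>A. r u ^ DIM('a)) * b = (\<Sum>u\<in>A. measure lborel (ball (p u) (r u)))"
    unfolding sum_distrib_right b_def
    by (rule sum.cong) (use r in \<open>auto simp: content_ball_conv_unit_ball[of _ "p _"]\<close>)
  also have "\<dots> = measure lborel (\<Union>u\<in>A. ball (p u) (r u))"
  proof (rule measure_finite_Union[symmetric, OF fin])
    show "disjoint_family_on (\<lambda>u. ball (p u) (r u)) A"
      using disj by (auto simp: disjoint_family_on_def)
    show "emeasure lborel (ball (p u) (r u)) \<noteq> \<infinity>" for u
      using emeasure_bounded_finite[OF bounded_ball, of "p u" "r u"] by (rule less_imp_neq)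
  qed auto
  also have "\<dots> \<le> measure lborel (cball x R)"
    by (rule measure_mono_fmeasurable)
      (use sub fin in \<open>auto intro!: fmeasurableI emeasure_bounded_finite\<close>)
  also have "\<dots> = R ^ DIM('a) * b" using R
    by (simp add: b_def content_ball content_cball)
  finally show ?thesis using b by simp
qed

lemma word_map_snoc: "word_map f l (w @ [i]) = word_map f l w \<circ> f (l + length w) i"
  by (induction w arbitrary: l) (auto simp: o_assoc)

text \<open>At a point where this holds, the definite description in \<open>scaling_factor\<close> denotes the ratio of
  the derivative; the property is closed under composition, and the ratios multiply.\<close>

definition conformal_at :: "('a::euclidean_space \<Rightarrow> 'a) \<Rightarrow> 'a \<Rightarrow> bool" where
  "conformal_at f x \<longleftrightarrow> (\<exists>L. (f has_derivative L) (at x) \<and> 0 < scaling_factor f x \<and>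
     (\<forall>h. norm (L h) = scaling_factor f x * norm h))"

lemma conformal_atI:
  assumes "(f has_derivative L) (at x)" "similarity_linear L"
  shows "conformal_at f x"
proof -
  obtain r where r: "r > 0" "\<And>h. norm (L h) = r * norm h"
    using assms(2) unfolding similarity_linear_def by blast
  then have "scaling_factor f x = r" using scaling_factor_eqI[OF assms(1)] by blast
  then show ?thesis unfolding conformal_at_def using assms(1) r by blast
qed

lemma conformal_at_compose:
  assumes "conformal_at g x" and "conformal_at f (g x)"
  shows "conformal_at (f \<circ> g) x"
    and "scaling_factor (f \<circ> g) x = scaling_factor f (g x) * scaling_factor g x"
proof -
  obtain L where L: "(g has_derivative L) (at x)" "0 < scaling_factor g x"
     "\<And>h. norm (L h) = scaling_factor g x * norm h"
    using assms(1) unfolding conformal_at_def by blast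
  obtain L' where L': "(f has_derivative L') (at (g x))" "0 < scaling_factor f (g x)"
     "\<And>h. norm (L' h) = scaling_factor f (g x) * norm h"
    using assms(2) unfolding conformal_at_def by blast
  have d: "(f \<circ> g has_derivative (L' \<circ> L)) (at x)"
    using diff_chain_at[OF L(1) L'(1)] .
  have n: "norm ((L' \<circ> L) h) = scaling_factor f (g x) * scaling_factor g x * norm h" for h
    using L(3) L'(3) by simp
  show sf: "scaling_factor (f \<circ> g) x = scaling_factor f (g x) * scaling_factor g x"
    using scaling_factor_eqI[OF d n] .
  show "conformal_at (f \<circ> g) x"
    unfolding conformal_at_def sf using d n L(2) L'(2) by (blast intro: mult_pos_pos)
qed

lemma conformal_at_id: "conformal_at id x" "scaling_factor id x = 1"
proof -
  show 1: "scaling_factor id x = 1"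
    by (rule scaling_factor_eqI[OF has_derivative_id]) simp
  show "conformal_at id x" unfolding conformal_at_def 1 using has_derivative_id by fastforce
qed

section \<open>Hausdorff and intermediate dimensions\<close>

lemma countable_cover_mono: "countable_cover E \<delta> U \<Longrightarrow> \<delta> \<le> \<delta>' \<Longrightarrow> countable_cover E \<delta>' U"
  unfolding countable_cover_def by (meson order_trans)

text \<open>The supremum over the scales and the infimum over the covers become quantifiers, which makes null
  sets comparable with the defining conditions of the intermediate dimensions.\<close>

lemma hausdorff_measure_eq_0_iff:
  "hausdorff_measure s E = 0 \<longleftrightarrow> (\<forall>\<delta>>0. \<forall>\<epsilon>>0. \<exists>U. countable_cover E \<delta> U \<and>
     (\<Sum>\<^sub>\<infinity>X\<in>U. diam_powr s X) \<le> ennreal \<epsilon>)"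
proof -
  have 1: "hausdorff_measure s E = 0 \<longleftrightarrow> (\<forall>\<delta>>0. hausdorff_premeasure s \<delta> E = 0)"
    unfolding hausdorff_measure_def bot_ennreal[symmetric] SUP_bot_conv by auto
  have 2: "hausdorff_premeasure s \<delta> E = 0 \<longleftrightarrow> (\<forall>\<epsilon>>0. \<exists>U. countable_cover E \<delta> U \<and>
     (\<Sum>\<^sub>\<infinity>X\<in>U. diam_powr s X) \<le> ennreal \<epsilon>)" for \<delta>
  proof
    assume H: "hausdorff_premeasure s \<delta> E = 0"
    show "\<forall>\<epsilon>>0. \<exists>U. countable_cover E \<delta> U \<and> (\<Sum>\<^sub>\<infinity>X\<in>U. diam_powr s X) \<le> ennreal \<epsilon>"
    proof (intro allI impI)
      fix \<epsilon> :: real assume "\<epsilon> > 0"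
      then have "hausdorff_premeasure s \<delta> E < ennreal \<epsilon>" using H by simp
      then show "\<exists>U. countable_cover E \<delta> U \<and> (\<Sum>\<^sub>\<infinity>X\<in>U. diam_powr s X) \<le> ennreal \<epsilon>"
        unfolding hausdorff_premeasure_def INF_less_iff by (auto intro: less_imp_le)
    qed
  next
    assume H: "\<forall>\<epsilon>>0. \<exists>U. countable_cover E \<delta> U \<and> (\<Sum>\<^sub>\<infinity>X\<in>U. diam_powr s X) \<le> ennreal \<epsilon>"
    have le: "hausdorff_premeasure s \<delta> E \<le> 0 + ennreal \<epsilon>" if e: "\<epsilon> > 0" for \<epsilon>
    proof -
      obtain U where U: "countable_cover E \<delta> U" "(\<Sum>\<^sub>\<infinity>X\<in>U. diam_powr s X) \<le> ennreal \<epsilon>"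
        using H e by blast
      have "hausdorff_premeasure s \<delta> E \<le> (\<Sum>\<^sub>\<infinity>X\<in>U. diam_powr s X)"
        unfolding hausdorff_premeasure_def using U(1) by (intro INF_lower) simp
      then show ?thesis using U(2) by simp
    qed
    have "hausdorff_premeasure s \<delta> E \<le> 0"
    proof (rule ennreal_le_epsilon)
      show "\<And>e. 0 < e \<Longrightarrow> hausdorff_premeasure s \<delta> E \<le> 0 + ennreal e" by (rule le)
    qed
    then show "hausdorff_premeasure s \<delta> E = 0" by simp
  qed
  show ?thesis unfolding 1 2 by blast
qed

text \<open>With no lower bound on the diameters, a cover at a small scale is also a cover at every larger
  scale, so the three different quantifications over the scale agree.\<close>

lemma intermediate_dim_0:
  "lower_intermediate_dim 0 E = hausdorff_dim E" "upper_intermediate_dim 0 E = hausdorff_dim E"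
proof -
  let ?C = "\<lambda>s \<delta> \<epsilon>. \<exists>U. countable_cover E \<delta> U \<and> (\<Sum>\<^sub>\<infinity>X\<in>U. diam_powr s X) \<le> ennreal \<epsilon>"
  have mono: "?C s \<delta>' \<epsilon>" if "?C s \<delta> \<epsilon>" "\<delta> \<le> \<delta>'" for s \<delta> \<delta>' \<epsilon>
    using that countable_cover_mono by blast
  have adm: "admissible_cover E 0 \<delta> U \<longleftrightarrow> countable_cover E \<delta> U" for \<delta> U
    by (simp add: admissible_cover_def)
  have 1: "(\<forall>\<epsilon>>0. \<forall>\<Delta>>0. \<exists>\<delta>. 0 < \<delta> \<and> \<delta> \<le> \<Delta> \<and> ?C s \<delta> \<epsilon>) \<longleftrightarrow> (\<forall>\<delta>>0. \<forall>\<epsilon>>0. ?C s \<delta> \<epsilon>)" for s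
  proof (intro iffI allI impI)
    fix \<delta> \<epsilon> :: real assume "\<forall>\<epsilon>>0. \<forall>\<Delta>>0. \<exists>\<delta>. 0 < \<delta> \<and> \<delta> \<le> \<Delta> \<and> ?C s \<delta> \<epsilon>" "\<delta> > 0" "\<epsilon> > 0"
    then obtain \<delta>' where "\<delta>' \<le> \<delta>" "?C s \<delta>' \<epsilon>" by blast
    then show "?C s \<delta> \<epsilon>" using mono by blast
  next
    fix \<epsilon> \<Delta> :: real assume "\<forall>\<delta>>0. \<forall>\<epsilon>>0. ?C s \<delta> \<epsilon>" "\<epsilon> > 0" "\<Delta> > 0"
    then show "\<exists>\<delta>. 0 < \<delta> \<and> \<delta> \<le> \<Delta> \<and> ?C s \<delta> \<epsilon>" by (intro exI[of _ \<Delta>]) simp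
  qed
  have 2: "(\<forall>\<epsilon>>0. \<exists>\<Delta>>0. \<forall>\<delta>. 0 < \<delta> \<and> \<delta> \<le> \<Delta> \<longrightarrow> ?C s \<delta> \<epsilon>) \<longleftrightarrow> (\<forall>\<delta>>0. \<forall>\<epsilon>>0. ?C s \<delta> \<epsilon>)" for s
  proof (intro iffI allI impI)
    fix \<delta> \<epsilon> :: real assume H: "\<forall>\<epsilon>>0. \<exists>\<Delta>>0. \<forall>\<delta>. 0 < \<delta> \<and> \<delta> \<le> \<Delta> \<longrightarrow> ?C s \<delta> \<epsilon>" "\<delta> > 0" "\<epsilon> > 0"
    then obtain \<Delta> where "\<Delta> > 0" "\<forall>\<delta>. 0 < \<delta> \<and> \<delta> \<le> \<Delta> \<longrightarrow> ?C s \<delta> \<epsilon>" by blast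
    then have "?C s (min \<delta> \<Delta>) \<epsilon>" using H(2) by simp
    then show "?C s \<delta> \<epsilon>" by (rule mono) simp
  next
    fix \<epsilon> :: real assume "\<forall>\<delta>>0. \<forall>\<epsilon>>0. ?C s \<delta> \<epsilon>" "\<epsilon> > 0"
    then show "\<exists>\<Delta>>0. \<forall>\<delta>. 0 < \<delta> \<and> \<delta> \<le> \<Delta> \<longrightarrow> ?C s \<delta> \<epsilon>" by (intro exI[of _ 1]) simp
  qed
  show "lower_intermediate_dim 0 E = hausdorff_dim E"
    unfolding lower_intermediate_dim_def hausdorff_dim_def adm hausdorff_measure_eq_0_iff 1 ..
  show "upper_intermediate_dim 0 E = hausdorff_dim E"
    unfolding upper_intermediate_dim_def hausdorff_dim_def adm hausdorff_measure_eq_0_iff 2 ..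
qed

text \<open>\<open>D\<close> stands for the exponents with cheap covers and \<open>P\<close> for those with negative pressure.\<close>

lemma Inf_eq_of_interlacing:
  fixes D P :: "real set"
  assumes lb: "\<And>s. s \<in> D \<Longrightarrow> 0 \<le> s" "\<And>t. t \<in> P \<Longrightarrow> 0 < t" and ne: "P \<noteq> {}"
    and PD: "\<And>s t. t \<in> P \<Longrightarrow> t < s \<Longrightarrow> s \<in> D" and DP: "\<And>s t. s \<in> D \<Longrightarrow> s < t \<Longrightarrow> t \<in> P"
  shows "Inf D = Inf P"
proof (rule antisym)
  have bD: "bdd_below D" using lb(1) by (rule bdd_belowI)
  have bP: "bdd_below P" by (rule bdd_belowI[of _ 0]) (use lb(2) in force)
  obtain t0 where "t0 \<in> P" using ne by blast
  then have "t0 + 1 \<in> D" by (rule PD) simp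
  then have neD: "D \<noteq> {}" by blast
  show "Inf D \<le> Inf P"
  proof (rule cInf_greatest[OF ne])
    fix t assume "t \<in> P"
    then have "Inf D \<le> x" if "t < x" for x using cInf_lower[OF PD[OF _ that] bD] by simp
    then show "Inf D \<le> t" by (rule dense_ge)
  qed
  show "Inf P \<le> Inf D"
  proof (rule cInf_greatest[OF neD])
    fix s assume "s \<in> D"
    then have "Inf P \<le> x" if "s < x" for x using cInf_lower[OF DP[OF _ that] bP] by simp
    then show "Inf P \<le> s" by (rule dense_ge)
  qed
qed

lemma sum_le_infsum_ennreal:
  fixes f :: "'b \<Rightarrow> ennreal"
  assumes "finite F" "F \<subseteq> A" shows "sum f F \<le> infsum f A"
proof -
  have "infsum f A = (SUP F\<in>{F. finite F \<and> F \<subseteq> A}. sum f F)"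
    by (rule nonneg_infsum_complete) simp
  then show ?thesis using SUP_upper[of F "{F. finite F \<and> F \<subseteq> A}" "sum f"] assms by simp
qed

section \<open>Conformal systems and bounded distortion\<close>

locale conformal_ifs =
  fixes I :: "nat \<Rightarrow> 'i set"
    and J V :: "'a::euclidean_space set"
    and \<phi> \<psi> :: "nat \<Rightarrow> 'i \<Rightarrow> 'a \<Rightarrow> 'a"
    and Jw :: "'i list \<Rightarrow> 'a set"
  assumes ifs: "nonautonomous_ifs I J \<phi> Jw"
    and conf: "conformal_extension I J \<phi> V \<psi>"
    and osc: "open_set_condition I Jw"
begin

abbreviation N :: "'i list \<Rightarrow> real" where "N \<equiv> word_norm J \<psi>"

text \<open>The starting level is a parameter, as in \<open>word_map\<close>, so that words can be taken apart from the
  left; the empty word is admissible at every level.\<close>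

definition admissible :: "nat \<Rightarrow> 'i list \<Rightarrow> bool" where
  "admissible l w \<longleftrightarrow> (\<forall>j<length w. w ! j \<in> I (l + j))"

lemma admissible_Nil [simp]: "admissible l []"
  by (simp add: admissible_def)

lemma admissible_Cons [simp]: "admissible l (i # w) \<longleftrightarrow> i \<in> I l \<and> admissible (Suc l) w"
  unfolding admissible_def by (simp add: All_less_Suc2)

lemma admissible_append [simp]:
  "admissible l (u @ v) \<longleftrightarrow> admissible l u \<and> admissible (l + length u) v"
  by (induction u arbitrary: l) auto

lemma words_iff: "u \<in> words I k \<longleftrightarrow> length u = k \<and> admissible 1 u"
  by (auto simp: words_def words_from_def admissible_def)

lemma all_words_iff: "u \<in> all_words I \<longleftrightarrow> admissible 1 u"
  by (auto simp: all_words_def words_iff)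

lemma admissible_take: "admissible l u \<Longrightarrow> admissible l (take n u)"
  by (auto simp: admissible_def)

lemma finite_I: "k \<ge> 1 \<Longrightarrow> finite (I k)" and I_nonempty: "k \<ge> 1 \<Longrightarrow> I k \<noteq> {}"
  using ifs unfolding nonautonomous_ifs_def by fastforce+

lemma compact_J: "compact J" and interior_J: "interior J \<noteq> {}" and J_nonempty: "J \<noteq> {}"
  using ifs interior_subset[of J] unfolding nonautonomous_ifs_def by auto

lemma open_V: "open V" and connected_V: "connected V" and J_V: "J \<subseteq> V"
  using conf unfolding conformal_extension_def by auto

lemma finite_words: "finite (words I k)"
proof -
  have "words I k \<subseteq> {xs. set xs \<subseteq> (\<Union>j\<in>{1..k}. I j) \<and> length xs = k}"
    unfolding words_iff admissible_def by (force simp: in_set_conv_nth words_iff admissible_def)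
  then show ?thesis
    by (rule finite_subset) (auto intro!: finite_lists_length_eq finite_I)
qed

lemma finite_short_words: "finite {u. admissible 1 u \<and> length u \<le> n}"
proof -
  have "{u. admissible 1 u \<and> length u \<le> n} = (\<Union>k\<le>n. words I k)" by (auto simp: words_iff)
  then show ?thesis using finite_words by simp
qed

lemma psi:
  assumes "k \<ge> 1" "i \<in> I k"
  shows psi_V: "x \<in> V \<Longrightarrow> \<psi> k i x \<in> V" and psi_inj: "inj_on (\<psi> k i) V"
    and psi_conformal: "x \<in> V \<Longrightarrow> conformal_at (\<psi> k i) x"
    and psi_J: "x \<in> J \<Longrightarrow> \<psi> k i x = \<phi> k i x" "x \<in> J \<Longrightarrow> \<phi> k i x \<in> J"
proof -
  have d: "conformal_diffeo_into V (\<psi> k i)"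
    using conf assms unfolding conformal_extension_def by blast
  show "x \<in> J \<Longrightarrow> \<psi> k i x = \<phi> k i x"
    using conf assms unfolding conformal_extension_def by blast
  have "\<forall>k\<ge>1. \<forall>i\<in>I k. \<phi> k i ` J \<subseteq> J"
    using ifs by (simp add: nonautonomous_ifs_def)
  then show "x \<in> J \<Longrightarrow> \<phi> k i x \<in> J"
    using assms by blast
  show "x \<in> V \<Longrightarrow> \<psi> k i x \<in> V" "inj_on (\<psi> k i) V"
    using d unfolding conformal_diffeo_into_def by blast+
  show "conformal_at (\<psi> k i) x" if x: "x \<in> V"
  proof (rule conformal_atI)
    show "similarity_linear (frechet_derivative (\<psi> k i) (at x))"
      using d x unfolding conformal_diffeo_into_def by blast
    show "(\<psi> k i has_derivative frechet_derivative (\<psi> k i) (at x)) (at x)"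
      using d x unfolding conformal_diffeo_into_def C1_on_def frechet_derivative_works[symmetric]
      by (blast intro: differentiableI)
  qed
qed

lemma word_map_conformal:
  assumes "l \<ge> 1" "admissible l w"
  shows word_map_inj: "inj_on (word_map \<psi> l w) V"
    and conformal_at_word_map: "x \<in> V \<Longrightarrow> conformal_at (word_map \<psi> l w) x"
proof -
  have "(\<forall>x\<in>V. word_map \<psi> l w x \<in> V) \<and> inj_on (word_map \<psi> l w) V \<and>
        (\<forall>x\<in>V. conformal_at (word_map \<psi> l w) x)"
    using assms
  proof (induction w arbitrary: l)
    case Nil
    then show ?case by (simp add: conformal_at_id(1)[unfolded id_def])
  next
    case (Cons i w)
    note p = psi[of l i]
    have IH: "\<forall>x\<in>V. word_map \<psi> (Suc l) w x \<in> V" "inj_on (word_map \<psi> (Suc l) w) V"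
      "\<forall>x\<in>V. conformal_at (word_map \<psi> (Suc l) w) x"
      using Cons by auto
    have "inj_on (\<psi> l i \<circ> word_map \<psi> (Suc l) w) V"
      by (rule comp_inj_on[OF IH(2)], rule inj_on_subset[OF p(2)]) (use IH Cons.prems in auto)
    moreover have "conformal_at (\<psi> l i \<circ> word_map \<psi> (Suc l) w) x" if "x \<in> V" for x
      by (rule conformal_at_compose(1)) (use that IH p Cons.prems in auto)
    moreover have "(\<psi> l i \<circ> word_map \<psi> (Suc l) w) x \<in> V" if "x \<in> V" for x
      using that IH p Cons.prems by simp
    ultimately show ?case unfolding word_map.simps by blast
  qed
  then show "inj_on (word_map \<psi> l w) V" "x \<in> V \<Longrightarrow> conformal_at (word_map \<psi> l w) x" by blast+
qed

lemma scaling_factor_pos: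
  "l \<ge> 1 \<Longrightarrow> admissible l w \<Longrightarrow> x \<in> V \<Longrightarrow> 0 < scaling_factor (word_map \<psi> l w) x"
  using conformal_at_word_map unfolding conformal_at_def by blast

lemma word_map_J:
  assumes "l \<ge> 1" "admissible l w" "x \<in> J"
  shows "word_map \<phi> l w x \<in> J" "word_map \<psi> l w x = word_map \<phi> l w x"
proof -
  have "word_map \<phi> l w x \<in> J \<and> word_map \<psi> l w x = word_map \<phi> l w x"
    using assms
  proof (induction w arbitrary: l)
    case (Cons i w)
    then have "word_map \<phi> (Suc l) w x \<in> J" "word_map \<psi> (Suc l) w x = word_map \<phi> (Suc l) w x"
      by auto
    then show ?case using psi_J[of l i] Cons.prems by simp
  qed simp
  then show "word_map \<phi> l w x \<in> J" "word_map \<psi> l w x = word_map \<phi> l w x" by blast+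
qed

lemma Jw_eq: 
  assumes "admissible 1 u"
  obtains \<omega> where "Jw u = (\<lambda>x. word_map \<psi> 1 u x + \<omega>) ` J"
proof -
  have "\<forall>u\<in>all_words I. \<exists>\<omega>. Jw u = (\<lambda>x. word_map \<phi> 1 u x + \<omega>) ` J"
    using ifs by (simp add: nonautonomous_ifs_def)
  then obtain \<omega> where "Jw u = (\<lambda>x. word_map \<phi> 1 u x + \<omega>) ` J"
    using assms all_words_iff by meson
  also have "\<dots> = (\<lambda>x. word_map \<psi> 1 u x + \<omega>) ` J"
    by (rule image_cong) (use word_map_J(2)[OF _ assms] in auto)
  finally show ?thesis using that by blast
qed

lemma word_map_lipschitz:
  obtains c where "0 < c" "c < 1"
    "\<And>l w x y. l \<ge> 1 \<Longrightarrow> admissible l w \<Longrightarrow> x \<in> J \<Longrightarrow> y \<in> J \<Longrightarrow>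
       norm (word_map \<psi> l w x - word_map \<psi> l w y) \<le> c ^ length w * norm (x - y)"
proof -
  have "\<exists>c. 0 < c \<and> c < 1 \<and> (\<forall>k\<ge>1. \<forall>i\<in>I k. \<forall>x\<in>J. \<forall>y\<in>J.
       norm (\<phi> k i x - \<phi> k i y) \<le> c * norm (x - y))"
    using ifs by (simp add: nonautonomous_ifs_def)
  then obtain c where c: "0 < c" "c < 1"
    "\<And>k i x y. k \<ge> 1 \<Longrightarrow> i \<in> I k \<Longrightarrow> x \<in> J \<Longrightarrow> y \<in> J \<Longrightarrow>
       norm (\<phi> k i x - \<phi> k i y) \<le> c * norm (x - y)"
    by blast
  have "norm (word_map \<phi> l w x - word_map \<phi> l w y) \<le> c ^ length w * norm (x - y)"
    if "l \<ge> 1" "admissible l w" "x \<in> J" "y \<in> J" for l w x y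
    using that
  proof (induction w arbitrary: l)
    case (Cons i w)
    have J: "word_map \<phi> (Suc l) w x \<in> J" "word_map \<phi> (Suc l) w y \<in> J"
      using word_map_J(1) Cons.prems by auto
    have "norm (word_map \<phi> l (i # w) x - word_map \<phi> l (i # w) y)
          \<le> c * norm (word_map \<phi> (Suc l) w x - word_map \<phi> (Suc l) w y)"
      using c(3)[OF _ _ J] Cons.prems by simp
    also have "\<dots> \<le> c * (c ^ length w * norm (x - y))"
      using Cons c(1) by (intro mult_left_mono) auto
    finally show ?case by (simp add: mult_ac)
  qed simp
  then show ?thesis using that[OF c(1,2)] word_map_J(2) by metis
qed

text \<open>The supremum in \<open>deriv_norm\<close> is finite because one scaling factor bounds all the others, and for
  the same reason it is comparable with the scaling factor at every single point of \<open>V\<close>.\<close>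

lemma bounded_distortion:
  obtains C where "C \<ge> 1"
    "\<And>l u x. l \<ge> 1 \<Longrightarrow> admissible l u \<Longrightarrow> x \<in> V \<Longrightarrow>
       scaling_factor (word_map \<psi> l u) x \<le> C * deriv_norm J (word_map \<psi> l u)"
    "\<And>l u x. l \<ge> 1 \<Longrightarrow> admissible l u \<Longrightarrow> x \<in> V \<Longrightarrow>
       deriv_norm J (word_map \<psi> l u) \<le> C * scaling_factor (word_map \<psi> l u) x"
proof -
  obtain C where C: "C \<ge> 1"
    "\<And>l k u x y. l \<ge> 1 \<Longrightarrow> k \<ge> l \<Longrightarrow> u \<in> words_from I l k \<Longrightarrow> x \<in> V \<Longrightarrow> y \<in> V \<Longrightarrow>
       scaling_factor (word_map \<psi> l u) x \<le> C * scaling_factor (word_map \<psi> l u) y"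
    using conf unfolding conformal_extension_def by meson
  have D: "scaling_factor (word_map \<psi> l u) x \<le> C * scaling_factor (word_map \<psi> l u) y"
    if "l \<ge> 1" "admissible l u" "x \<in> V" "y \<in> V" for l u x y
  proof (cases "u = []")
    case True
    then show ?thesis using C(1) by (simp add: conformal_at_id)
  next
    case False
    then have "u \<in> words_from I l (l + length u - 1)"
      using that by (auto simp: words_from_def admissible_def)
    moreover have "l \<le> l + length u - 1" using False by (cases u) auto
    ultimately show ?thesis using C(2) that by blast
  qed
  have bdd: "bdd_above (scaling_factor (word_map \<psi> l u) ` J)" if "l \<ge> 1" "admissible l u" for l u
  proof -
    obtain y where "y \<in> J" using J_nonempty by blast
    then show ?thesis using D[OF that] J_V by (intro bdd_aboveI2) blast
  qed
  show ?thesis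
  proof (rule that[OF C(1)])
    fix l :: nat and u x assume a: "l \<ge> 1" "admissible l u" "x \<in> V"
    show "deriv_norm J (word_map \<psi> l u) \<le> C * scaling_factor (word_map \<psi> l u) x"
      unfolding deriv_norm_def using D[OF a(1,2) _ a(3)] J_V J_nonempty
      by (intro cSUP_least) auto
    obtain y where y: "y \<in> J" using J_nonempty by blast
    have "scaling_factor (word_map \<psi> l u) x \<le> C * scaling_factor (word_map \<psi> l u) y"
      using D[OF a] y J_V by blast
    also have "\<dots> \<le> C * deriv_norm J (word_map \<psi> l u)"
      unfolding deriv_norm_def using cSUP_upper[OF y bdd[OF a(1,2)]] C(1) by simp
    finally show "scaling_factor (word_map \<psi> l u) x \<le> C * deriv_norm J (word_map \<psi> l u)" .
  qed
qed

lemma deriv_norm_pos: 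
  assumes "l \<ge> 1" "admissible l u"
  shows "0 < deriv_norm J (word_map \<psi> l u)"
proof -
  obtain x where x: "x \<in> V" using J_nonempty J_V by blast
  obtain C where "C \<ge> 1" "scaling_factor (word_map \<psi> l u) x \<le> C * deriv_norm J (word_map \<psi> l u)"
    using bounded_distortion assms x by metis
  then show ?thesis using scaling_factor_pos[OF assms x]
    by (smt (verit) mult_nonneg_nonpos)
qed

lemma N_pos: "admissible 1 u \<Longrightarrow> 0 < N u"
  unfolding word_norm_def using deriv_norm_pos by simp

lemma N_Nil: "N [] = 1"
  using J_nonempty by (simp add: word_norm_def deriv_norm_def conformal_at_id)

text \<open>At an interior point of \<open>J\<close> the derivative of a composed map inherits the Lipschitz constant
  \<open>c ^ length u\<close>; the factor \<open>C\<close> is the distortion constant.\<close>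

lemma N_decay:
  obtains C c where "C \<ge> 1" "0 < c" "c < 1" "\<And>u. admissible 1 u \<Longrightarrow> N u \<le> C * c ^ length u"
proof -
  obtain C where C: "C \<ge> 1"
    "\<And>l u x. l \<ge> 1 \<Longrightarrow> admissible l u \<Longrightarrow> x \<in> V \<Longrightarrow>
       deriv_norm J (word_map \<psi> l u) \<le> C * scaling_factor (word_map \<psi> l u) x"
    using bounded_distortion by metis
  obtain c where c: "0 < c" "c < 1"
    "\<And>l w x y. l \<ge> 1 \<Longrightarrow> admissible l w \<Longrightarrow> x \<in> J \<Longrightarrow> y \<in> J \<Longrightarrow>
       norm (word_map \<psi> l w x - word_map \<psi> l w y) \<le> c ^ length w * norm (x - y)"
    using word_map_lipschitz by metis
  obtain x where x: "x \<in> interior J" using interior_J by blast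
  then have xJ: "x \<in> J" "x \<in> V" using interior_subset J_V by blast+
  show ?thesis
  proof (rule that[OF C(1) c(1,2)])
    fix u assume u: "admissible 1 u"
    obtain L where L: "(word_map \<psi> 1 u has_derivative L) (at x)"
      "\<And>h. norm (L h) = scaling_factor (word_map \<psi> 1 u) x * norm h"
      using conformal_at_word_map[OF _ u xJ(2)] unfolding conformal_at_def by auto
    obtain e :: 'a where "e \<in> Basis" using nonempty_Basis by blast
    then have e: "norm e = 1" by simp
    have "norm (L e) \<le> c ^ length u * norm e"
      by (rule norm_derivative_le_lipschitz[OF L(1) x]) (use c(3)[OF _ u _ xJ(1)] in auto)
    then have "scaling_factor (word_map \<psi> 1 u) x \<le> c ^ length u" using L(2)[of e] e by simp
    then have "C * scaling_factor (word_map \<psi> 1 u) x \<le> C * c ^ length u" using C(1) by simp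
    then show "N u \<le> C * c ^ length u"
      using C(2)[OF _ u xJ(2)] unfolding word_norm_def by force
  qed
qed

text \<open>The chain rule factors the derivative of the longer word at a point; each factor is at least the
  corresponding norm divided by the distortion constant.\<close>

lemma N_snoc_ge:
  obtains B where "B > 0"
    "\<And>u i. admissible 1 (u @ [i]) \<Longrightarrow>
       N u * deriv_norm J (\<psi> (Suc (length u)) i) \<le> B * N (u @ [i])"
proof -
  obtain C where C: "C \<ge> 1"
    "\<And>l u x. l \<ge> 1 \<Longrightarrow> admissible l u \<Longrightarrow> x \<in> V \<Longrightarrow>
       scaling_factor (word_map \<psi> l u) x \<le> C * deriv_norm J (word_map \<psi> l u)"
    "\<And>l u x. l \<ge> 1 \<Longrightarrow> admissible l u \<Longrightarrow> x \<in> V \<Longrightarrow>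
       deriv_norm J (word_map \<psi> l u) \<le> C * scaling_factor (word_map \<psi> l u) x"
    using bounded_distortion by metis
  obtain x where x: "x \<in> V" using J_nonempty J_V by blast
  show ?thesis
  proof (rule that[of "C ^ 3"])
    fix u i assume ui: "admissible 1 (u @ [i])"
    then have u: "admissible 1 u" and i: "i \<in> I (Suc (length u))" by auto
    let ?p = "\<psi> (Suc (length u)) i"
    have px: "?p x \<in> V" using psi_V[OF _ i x] by simp
    have "deriv_norm J ?p \<le> C * scaling_factor ?p x"
      using C(3)[of "Suc (length u)" "[i]", OF _ _ x] i by simp
    moreover have "N u \<le> C * scaling_factor (word_map \<psi> 1 u) (?p x)"
      unfolding word_norm_def using C(3)[OF _ u px] by simp
    moreover have "0 < deriv_norm J ?p"
      using deriv_norm_pos[of "Suc (length u)" "[i]"] i by simp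
    ultimately have "N u * deriv_norm J ?p
       \<le> (C * scaling_factor (word_map \<psi> 1 u) (?p x)) * (C * scaling_factor ?p x)"
      using N_pos[OF u] by (intro mult_mono) auto
    also have "\<dots> = C ^ 2 * scaling_factor (word_map \<psi> 1 (u @ [i])) x"
      using conformal_at_compose(2)[OF psi_conformal[OF _ i x] conformal_at_word_map[OF _ u px]]
      by (simp add: word_map_snoc power2_eq_square)
    also have "\<dots> \<le> C ^ 2 * (C * N (u @ [i]))"
      using C(2)[OF _ ui x] unfolding word_norm_def by (intro mult_left_mono) auto
    finally show "N u * deriv_norm J ?p \<le> C ^ 3 * N (u @ [i])"
      by (simp add: power2_eq_square power3_eq_cube mult_ac)
  qed (use C(1) in simp)
qed

section \<open>Size and separation of the basic sets\<close>

text \<open>On a ball inside \<open>V\<close> the mean value inequality applies, but \<open>V\<close> need not be convex.  Having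
  images at distance \<open>O(N u)\<close> uniformly in \<open>u\<close> is an equivalence relation on \<open>V\<close> with open classes,
  so by connectedness any two points are related; compactness of \<open>J\<close> makes the constant uniform.\<close>

lemma Jw_dist_le:
  obtains K where "K > 0"
    "\<And>u x y. admissible 1 u \<Longrightarrow> x \<in> Jw u \<Longrightarrow> y \<in> Jw u \<Longrightarrow> dist x y \<le> K * N u"
proof -
  obtain C where C: "C \<ge> 1"
    "\<And>l u x. l \<ge> 1 \<Longrightarrow> admissible l u \<Longrightarrow> x \<in> V \<Longrightarrow>
       scaling_factor (word_map \<psi> l u) x \<le> C * deriv_norm J (word_map \<psi> l u)"
    using bounded_distortion by metis
  have loc: "norm (word_map \<psi> 1 u a - word_map \<psi> 1 u z) \<le> C * r * N u"
    if sub: "ball a r \<subseteq> V" and z: "z \<in> ball a r" and u: "admissible 1 u" for a r z u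
  proof -
    have "\<forall>x\<in>V. \<exists>L. (word_map \<psi> 1 u has_derivative L) (at x) \<and> onorm L \<le> C * N u"
    proof
      fix x assume x: "x \<in> V"
      obtain L where L: "(word_map \<psi> 1 u has_derivative L) (at x)"
        "\<And>h. norm (L h) = scaling_factor (word_map \<psi> 1 u) x * norm h"
        using conformal_at_word_map[OF _ u x] unfolding conformal_at_def by auto
      have "onorm L \<le> C * N u"
        by (rule onorm_le) (use L(2) C(2)[OF _ u x] in \<open>auto simp: word_norm_def intro!: mult_right_mono\<close>)
      then show "\<exists>L. (word_map \<psi> 1 u has_derivative L) (at x) \<and> onorm L \<le> C * N u"
        using L(1) by blast
    qed
    then obtain L where L: "\<And>x. x \<in> V \<Longrightarrow> (word_map \<psi> 1 u has_derivative L x) (at x) \<and> onorm (L x) \<le> C * N u"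
      by metis
    have "r > 0" using z le_less_trans[OF zero_le_dist] by (metis mem_ball)
    then have "a \<in> ball a r" by simp
    have "norm (word_map \<psi> 1 u a - word_map \<psi> 1 u z) \<le> C * N u * norm (a - z)"
    proof (rule differentiable_bound[where S = "ball a r" and f' = L])
      show "\<And>x. x \<in> ball a r \<Longrightarrow> (word_map \<psi> 1 u has_derivative L x) (at x within ball a r)"
        using L sub has_derivative_at_withinI by blast
    qed (use L sub z \<open>a \<in> ball a r\<close> in auto)
    also have "\<dots> \<le> C * N u * r"
      using z C(1) N_pos[OF u] by (intro mult_left_mono) (auto simp: dist_norm)
    finally show ?thesis by (simp add: mult_ac)
  qed
  define R where "R a b \<longleftrightarrow> (\<exists>K\<ge>0. \<forall>u. admissible 1 u \<longrightarrow>
      norm (word_map \<psi> 1 u a - word_map \<psi> 1 u b) \<le> K * N u)" for a b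
  have Rsym: "R y x" if "R x y" for x y
    using that unfolding R_def by (metis norm_minus_commute)
  have Rtrans: "R x z" if xy: "R x y" and yz: "R y z" for x y z
  proof -
    obtain K where K: "K \<ge> 0" "\<And>u. admissible 1 u \<Longrightarrow>
      norm (word_map \<psi> 1 u x - word_map \<psi> 1 u y) \<le> K * N u" using xy unfolding R_def by blast
    obtain K' where K': "K' \<ge> 0" "\<And>u. admissible 1 u \<Longrightarrow>
      norm (word_map \<psi> 1 u y - word_map \<psi> 1 u z) \<le> K' * N u" using yz unfolding R_def by blast
    show ?thesis unfolding R_def
    proof (intro exI[of _ "K + K'"] conjI allI impI)
      fix u assume u: "admissible 1 u"
      show "norm (word_map \<psi> 1 u x - word_map \<psi> 1 u z) \<le> (K + K') * N u"
        using norm_triangle_le[OF add_mono[OF K(2)[OF u] K'(2)[OF u]]] by (simp add: algebra_simps)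
    qed (use K K' in auto)
  qed
  have R: "R a b" if "a \<in> V" "b \<in> V" for a b
  proof (rule connected_equivalence_relation[OF connected_V that])
    fix a assume "a \<in> V"
    then obtain r where r: "r > 0" "ball a r \<subseteq> V" using open_V open_contains_ball by blast
    have "\<forall>x\<in>ball a r. R a x"
    proof
      fix x assume x: "x \<in> ball a r"
      show "R a x" unfolding R_def using loc[OF r(2) x] r(1) C(1)
        by (intro exI[of _ "C * r"]) auto
    qed
    then show "\<exists>T. openin (top_of_set V) T \<and> a \<in> T \<and> (\<forall>x\<in>T. R a x)"
      using r by (intro exI[of _ "ball a r"]) (auto simp: openin_open_eq[OF open_V])
  qed (use Rsym Rtrans in blast)+
  obtain x0 where x0: "x0 \<in> J" using J_nonempty by blast
  have "\<forall>a\<in>J. \<exists>r>0. ball a r \<subseteq> V" using open_V J_V open_contains_ball by blast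
  then obtain r where r: "\<And>a. a \<in> J \<Longrightarrow> r a > 0 \<and> ball a (r a) \<subseteq> V" by metis
  have "J \<subseteq> (\<Union>a\<in>J. ball a (r a))" using r by fastforce
  then obtain T where T: "T \<subseteq> J" "finite T" "J \<subseteq> (\<Union>a\<in>T. ball a (r a))"
    using compactE_image[OF compact_J, of J "\<lambda>a. ball a (r a)"] by (metis open_ball)
  have "\<forall>a\<in>J. \<exists>K\<ge>0. \<forall>u. admissible 1 u \<longrightarrow> norm (word_map \<psi> 1 u x0 - word_map \<psi> 1 u a) \<le> K * N u"
    using R[of x0] x0 J_V unfolding R_def by blast
  then obtain k where k: "\<And>a. a \<in> J \<Longrightarrow> k a \<ge> 0" 
    "\<And>a u. a \<in> J \<Longrightarrow> admissible 1 u \<Longrightarrow> norm (word_map \<psi> 1 u x0 - word_map \<psi> 1 u a) \<le> k a * N u"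
    by metis
  define K where "K = (\<Sum>a\<in>T. k a + C * r a)"
  have nn: "0 \<le> k a + C * r a" if "a \<in> T" for a
  proof -
    have a: "a \<in> J" using that T(1) by blast
    show ?thesis using k(1)[OF a] r[OF a] C(1) by simp
  qed
  have far: "norm (word_map \<psi> 1 u x0 - word_map \<psi> 1 u z) \<le> K * N u" if u: "admissible 1 u" and z: "z \<in> J" for u z
  proof -
    obtain a where a: "a \<in> T" "z \<in> ball a (r a)" using T(3) z by blast
    have aJ: "a \<in> J" using a T by blast
    have "norm (word_map \<psi> 1 u x0 - word_map \<psi> 1 u z) \<le> k a * N u + C * r a * N u"
      using norm_triangle_le[OF add_mono[OF k(2)[OF aJ u] loc[OF _ a(2) u]]] r[OF aJ] by simp
    also have "\<dots> = (k a + C * r a) * N u" by (simp add: algebra_simps)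
    also have "\<dots> \<le> K * N u"
      unfolding K_def using N_pos[OF u] member_le_sum[OF a(1), of "\<lambda>a. k a + C * r a"] nn T(2)
      by (intro mult_right_mono) auto
    finally show ?thesis .
  qed
  have K0: "K \<ge> 0" unfolding K_def using nn by (rule sum_nonneg)
  show ?thesis
  proof (rule that[of "2 * K + 1"])
    fix u x y assume u: "admissible 1 u" and xy: "x \<in> Jw u" "y \<in> Jw u"
    obtain \<omega> where \<omega>: "Jw u = (\<lambda>x. word_map \<psi> 1 u x + \<omega>) ` J" using Jw_eq[OF u] .
    obtain x' y' where x': "x' \<in> J" "x = word_map \<psi> 1 u x' + \<omega>" and y': "y' \<in> J" "y = word_map \<psi> 1 u y' + \<omega>"
      using xy \<omega> by blast
    have "dist x y = norm (word_map \<psi> 1 u x' - word_map \<psi> 1 u y')"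
      using x' y' by (simp add: dist_norm)
    also have "\<dots> \<le> K * N u + K * N u"
      using norm_triangle_ineq4[of "word_map \<psi> 1 u x0 - word_map \<psi> 1 u y'" "word_map \<psi> 1 u x0 - word_map \<psi> 1 u x'"]
        far[OF u x'(1)] far[OF u y'(1)] by simp
    also have "\<dots> \<le> (2 * K + 1) * N u" using N_pos[OF u] by (simp add: algebra_simps)
    finally show "dist x y \<le> (2 * K + 1) * N u" .
  qed (use K0 in simp)
qed

text \<open>Take a ball inside \<open>J\<close>.  The derivative of the composed map expands by at least \<open>N u / C\<close> on it,
  with \<open>C\<close> the distortion constant, and translating the image does not matter.\<close>

lemma Jw_contains_ball:
  obtains \<kappa> where "\<kappa> > 0" "\<And>u. admissible 1 u \<Longrightarrow> \<exists>p. ball p (\<kappa> * N u) \<subseteq> Jw u"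
proof -
  obtain C where C: "C \<ge> 1"
    "\<And>l u x. l \<ge> 1 \<Longrightarrow> admissible l u \<Longrightarrow> x \<in> V \<Longrightarrow>
       deriv_norm J (word_map \<psi> l u) \<le> C * scaling_factor (word_map \<psi> l u) x"
    using bounded_distortion by metis
  obtain x0 r where r: "r > 0" "ball x0 r \<subseteq> J" using interior_J mem_interior by blast
  show ?thesis
  proof (rule that[of "r / C"])
    fix u assume u: "admissible 1 u"
    let ?f = "word_map \<psi> 1 u"
    obtain \<omega> where \<omega>: "Jw u = (\<lambda>x. ?f x + \<omega>) ` J" using Jw_eq[OF u] .
    have "\<forall>x\<in>ball x0 r. \<exists>L. (?f has_derivative L) (at x) \<and> (\<forall>h. N u / C * norm h \<le> norm (L h))"
    proof
      fix x assume "x \<in> ball x0 r"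
      then have x: "x \<in> V" using r J_V by blast
      obtain L where L: "(?f has_derivative L) (at x)" "\<And>h. norm (L h) = scaling_factor ?f x * norm h"
        using conformal_at_word_map[OF _ u x] unfolding conformal_at_def by auto
      have "N u / C \<le> scaling_factor ?f x"
        using C(2)[OF _ u x] C(1) unfolding word_norm_def by (simp add: divide_le_eq mult.commute)
      then show "\<exists>L. (?f has_derivative L) (at x) \<and> (\<forall>h. N u / C * norm h \<le> norm (L h))"
        using L by (metis mult_right_mono norm_ge_zero)
    qed
    then obtain L where L: "\<And>x. x \<in> ball x0 r \<Longrightarrow> (?f has_derivative L x) (at x)"
      "\<And>x h. x \<in> ball x0 r \<Longrightarrow> N u / C * norm h \<le> norm (L x h)" by metis
    have "ball (?f x0) (N u / C * r) \<subseteq> ?f ` ball x0 r"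
    proof (rule image_ball_contains_ball[OF r(1) _ _ L])
      show "inj_on ?f (ball x0 r)" 
        by (rule inj_on_subset[OF word_map_inj[OF _ u]]) (use r J_V in auto)
      show "N u / C > 0" using N_pos[OF u] C(1) by simp
    qed
    then have sub: "ball (?f x0) (r / C * N u) \<subseteq> ?f ` J" using r(2) by (auto simp: mult_ac)
    have "ball (?f x0 + \<omega>) (r / C * N u) \<subseteq> Jw u"
    proof
      fix y assume "y \<in> ball (?f x0 + \<omega>) (r / C * N u)"
      then have "y - \<omega> \<in> ball (?f x0) (r / C * N u)" by (simp add: dist_norm algebra_simps)
      then obtain z where "z \<in> J" "y - \<omega> = ?f z" using sub by blast
      then show "y \<in> Jw u" unfolding \<omega> by (intro image_eqI[of _ _ z]) (auto simp: algebra_simps)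
    qed
    then show "\<exists>p. ball p (r / C * N u) \<subseteq> Jw u" by blast
  qed (use r C in simp)
qed

text \<open>Neither word is a prefix of the other.  The members of a cut set are pairwise related in this way.\<close>

definition branching :: "'i list \<Rightarrow> 'i list \<Rightarrow> bool" where
  "branching u v \<longleftrightarrow> (\<exists>j. j < length u \<and> j < length v \<and> u ! j \<noteq> v ! j)"

lemma Jw_append_subset: "admissible 1 (u @ v) \<Longrightarrow> Jw (u @ v) \<subseteq> Jw u"
proof (induction v rule: rev_induct)
  case (snoc i v)
  have step: "\<forall>k\<ge>1. \<forall>u\<in>words I (k - 1). \<forall>i\<in>I k. Jw (u @ [i]) \<subseteq> Jw u"
    using ifs by (simp add: nonautonomous_ifs_def)
  have "Jw ((u @ v) @ [i]) \<subseteq> Jw (u @ v)"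
    using step[rule_format, of "Suc (length (u @ v))" "u @ v" i] snoc.prems by (simp add: words_iff)
  then show ?case using snoc by auto
qed simp

lemma Jw_subset_take: "admissible 1 u \<Longrightarrow> Jw u \<subseteq> Jw (take n u)"
  using Jw_append_subset[of "take n u" "drop n u"] by simp

text \<open>At the first position where the words differ, the open set condition separates the two basic
  sets one letter below the common prefix, and these contain the given ones.\<close>

lemma interior_Jw_disjoint:
  assumes "admissible 1 u" "admissible 1 v" "branching u v"
  shows "interior (Jw u) \<inter> interior (Jw v) = {}"
proof -
  define j where "j = (LEAST j. j < length u \<and> j < length v \<and> u ! j \<noteq> v ! j)"
  have j: "j < length u" "j < length v" "u ! j \<noteq> v ! j"
    using LeastI_ex[OF assms(3)[unfolded branching_def]] unfolding j_def by auto
  have eq: "u ! i = v ! i" if "i < j" for i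
    using not_less_Least[OF that[unfolded j_def]] that j(1,2) by auto
  have t: "take j v = take j u" using j eq by (intro nth_equalityI) auto
  have tu: "take (Suc j) u = take j u @ [u ! j]" using j(1) by (rule take_Suc_conv_app_nth)
  have tv: "take (Suc j) v = take j u @ [v ! j]" using take_Suc_conv_app_nth[OF j(2)] t by simp
  have w: "take j u \<in> words I j" using j(1) assms(1) by (simp add: words_iff admissible_take)
  have i: "u ! j \<in> I (j + 1)" "v ! j \<in> I (j + 1)" using assms(1,2) j by (auto simp: admissible_def)
  have "interior (Jw (take (Suc j) u)) \<inter> interior (Jw (take (Suc j) v)) = {}"
    using osc w i j(3) unfolding open_set_condition_def tu tv by meson
  moreover have "interior (Jw u) \<subseteq> interior (Jw (take (Suc j) u))"
      "interior (Jw v) \<subseteq> interior (Jw (take (Suc j) v))"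
    using Jw_subset_take[OF assms(1)] Jw_subset_take[OF assms(2)] by (simp_all add: interior_mono)
  ultimately show ?thesis by blast
qed

text \<open>The balls contained in the basic sets are disjoint by the open set condition, so their total
  volume is at most that of the ball around all of them.\<close>

lemma sum_norm_power_le:
  obtains \<kappa> where "\<kappa> > 0" "\<And>A x R. finite A \<Longrightarrow> R \<ge> 0 \<Longrightarrow> (\<And>u. u \<in> A \<Longrightarrow> admissible 1 u) \<Longrightarrow>
     pairwise branching A \<Longrightarrow> (\<And>u. u \<in> A \<Longrightarrow> Jw u \<subseteq> cball x R) \<Longrightarrow>
     (\<Sum>u\<in>A. N u ^ DIM('a)) \<le> (R / \<kappa>) ^ DIM('a)"
proof -
  obtain \<kappa> where \<kappa>: "\<kappa> > 0" "\<And>u. admissible 1 u \<Longrightarrow> \<exists>p. ball p (\<kappa> * N u) \<subseteq> Jw u"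
    using Jw_contains_ball by blast
  show ?thesis
  proof (rule that[OF \<kappa>(1)])
    fix A x and R :: real
    assume A: "finite A" "R \<ge> 0" "\<And>u. u \<in> A \<Longrightarrow> admissible 1 u" "pairwise branching A"
      "\<And>u. u \<in> A \<Longrightarrow> Jw u \<subseteq> cball x R"
    obtain p where p: "\<And>u. u \<in> A \<Longrightarrow> ball (p u) (\<kappa> * N u) \<subseteq> Jw u"
      using \<kappa>(2) A(3) by metis
    have "(\<Sum>u\<in>A. (\<kappa> * N u) ^ DIM('a)) \<le> R ^ DIM('a)"
    proof (rule sum_power_radii_le_of_disjoint_balls[where p = p and x = x])
      fix u v assume uv: "u \<in> A" "v \<in> A" "u \<noteq> v"
      have "interior (Jw u) \<inter> interior (Jw v) = {}"
        using interior_Jw_disjoint A(3,4) uv by (meson pairwiseD)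
      moreover have "ball (p u) (\<kappa> * N u) \<subseteq> interior (Jw u)" "ball (p v) (\<kappa> * N v) \<subseteq> interior (Jw v)"
        using p uv by (simp_all add: interior_maximal)
      ultimately show "ball (p u) (\<kappa> * N u) \<inter> ball (p v) (\<kappa> * N v) = {}" by blast
    next
      show "\<And>u. u \<in> A \<Longrightarrow> 0 \<le> \<kappa> * N u" using \<kappa>(1) N_pos[OF A(3)] by (simp add: less_imp_le)
    qed (use A p in blast)+
    then have "(\<Sum>u\<in>A. N u ^ DIM('a)) * \<kappa> ^ DIM('a) \<le> R ^ DIM('a)"
      by (simp add: power_mult_distrib sum_distrib_left mult.commute)
    then show "(\<Sum>u\<in>A. N u ^ DIM('a)) \<le> (R / \<kappa>) ^ DIM('a)"
      using \<kappa>(1) by (simp add: power_divide pos_le_divide_eq)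
  qed
qed

section \<open>Cut sets\<close>

abbreviation initial :: "(nat \<Rightarrow> 'i) \<Rightarrow> nat \<Rightarrow> 'i list" where
  "initial v n \<equiv> map v [0..<n]"

lemma admissible_initial: "v \<in> infinite_words I \<Longrightarrow> admissible 1 (initial v n)"
  by (simp add: infinite_words_def admissible_def)

lemma cylinder_iff: "v \<in> cylinder I u \<longleftrightarrow> v \<in> infinite_words I \<and> initial v (length u) = u"
proof -
  have "initial v (length u) = u \<longleftrightarrow> (\<forall>j<length u. v j = u ! j)"
    by (subst list_eq_iff_nth_eq) simp
  then show ?thesis by (simp add: cylinder_def)
qed

lemma take_initial: "m \<le> n \<Longrightarrow> take m (initial v n) = initial v m"
  by (simp add: take_map)

lemma butlast_initial: "butlast (initial v (Suc n)) = initial v n"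
  by simp

lemma extend_word:
  assumes "admissible 1 u" obtains v where "v \<in> cylinder I u"
proof -
  define v where "v j = (if j < length u then u ! j else (SOME i. i \<in> I (Suc j)))" for j
  have "v j \<in> I (Suc j)" for j
    using assms I_nonempty[of "Suc j"] by (auto simp: v_def admissible_def some_in_eq)
  then have "v \<in> cylinder I u" by (auto simp: cylinder_def infinite_words_def v_def)
  then show ?thesis using that by blast
qed

text \<open>Norms decay with the length, so a word of large norm is short; this is what makes all cut sets
  with bounded scale finite.\<close>

lemma length_bound_of_norm:
  assumes "\<epsilon> > 0"
  obtains n where "\<And>u. admissible 1 u \<Longrightarrow> \<epsilon> < N u \<Longrightarrow> length u < n"
proof -
  obtain C c where C: "C \<ge> 1" "0 < c" "c < 1" "\<And>u. admissible 1 u \<Longrightarrow> N u \<le> C * c ^ length u"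
    using N_decay by metis
  obtain n where n: "c ^ n < \<epsilon> / C" using real_arch_pow_inv[of "\<epsilon> / C" c] assms C by auto
  show ?thesis
  proof (rule that, rule ccontr)
    fix u assume u: "admissible 1 u" "\<epsilon> < N u" "\<not> length u < n"
    have "C * c ^ length u \<le> C * c ^ n" using u(3) C by (simp add: power_decreasing)
    also have "\<dots> < \<epsilon>" using n C(1) by (simp add: field_simps)
    finally show False using C(4)[OF u(1)] u(2) by simp
  qed
qed

lemma finite_large_norm:
  assumes "\<epsilon> > 0" shows "finite {u. admissible 1 u \<and> \<epsilon> < N (butlast u)}"
proof -
  obtain n where n: "\<And>u. admissible 1 u \<Longrightarrow> \<epsilon> < N u \<Longrightarrow> length u < n"
    using length_bound_of_norm[OF assms] by blast
  have "{u. admissible 1 u \<and> \<epsilon> < N (butlast u)} \<subseteq> {u. admissible 1 u \<and> length u \<le> n}"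
    using n admissible_take by (auto simp: butlast_conv_take) fastforce
  then show ?thesis using finite_short_words finite_subset by blast
qed

text \<open>There are only finitely many words of length at most \<open>n\<close>, and their norms are positive.\<close>

lemma length_gt_of_small_norm:
  obtains \<rho> where "\<rho> > 0" "\<And>u. admissible 1 u \<Longrightarrow> N u \<le> \<rho> \<Longrightarrow> n < length u"
proof -
  let ?W = "{u. admissible 1 u \<and> length u \<le> n}"
  have ne: "?W \<noteq> {}" by (auto intro!: exI[of _ "[]"])
  have pos: "Min (N ` ?W) > 0" using finite_short_words ne N_pos by (subst Min_gr_iff) auto
  show ?thesis
  proof (rule that[of "Min (N ` ?W) / 2"])
    fix u assume u: "admissible 1 u" "N u \<le> Min (N ` ?W) / 2"
    show "n < length u"
    proof (rule ccontr)
      assume "\<not> n < length u"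
      then have "Min (N ` ?W) \<le> N u" using u(1) finite_short_words by (intro Min_le) auto
      then show False using u(2) pos by simp
    qed
  qed (use pos in simp)
qed

lemma stopping_word:
  assumes "v \<in> infinite_words I" "0 < \<rho>" "\<rho> < 1"
  obtains n where "N (initial v n) \<le> \<rho>" "\<rho> < N (butlast (initial v n))"
proof -
  obtain n0 where n0: "\<And>u. admissible 1 u \<Longrightarrow> \<rho> < N u \<Longrightarrow> length u < n0"
    using length_bound_of_norm[OF assms(2)] by blast
  have ex: "\<exists>n. N (initial v n) \<le> \<rho>"
    using n0[OF admissible_initial[OF assms(1)], of n0] by (intro exI[of _ n0] leI) auto
  define n where "n = (LEAST n. N (initial v n) \<le> \<rho>)"
  have n: "N (initial v n) \<le> \<rho>" unfolding n_def using ex by (rule LeastI_ex)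
  then have "n \<noteq> 0" using N_Nil assms(3) by (intro notI) simp
  then obtain m where m: "n = Suc m" using not0_implies_Suc by blast
  have "\<not> N (initial v m) \<le> \<rho>" using not_less_Least[of m "\<lambda>n. N (initial v n) \<le> \<rho>"] m n_def by simp
  then show ?thesis using that[OF n] m butlast_initial by simp
qed

text \<open>Any family of words that meets every infinite word can be thinned out to a cut set by
  keeping, along each infinite word, the shortest prefix in the family.\<close>

lemma minimal_words_cut_set:
  assumes "S \<subseteq> all_words I" and cov: "\<And>v. v \<in> infinite_words I \<Longrightarrow> \<exists>n. initial v n \<in> S"
  shows "cut_set I {u \<in> S. \<forall>n<length u. take n u \<notin> S}" (is "cut_set I ?A")
  unfolding cut_set_def
proof (intro conjI ballI impI)
  show "infinite_words I \<subseteq> (\<Union>u\<in>?A. cylinder I u)"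
  proof
    fix v assume v: "v \<in> infinite_words I"
    define n where "n = (LEAST n. initial v n \<in> S)"
    have n: "initial v n \<in> S" unfolding n_def using cov[OF v] by (rule LeastI_ex)
    have "initial v m \<notin> S" if "m < n" for m using not_less_Least that unfolding n_def by blast
    then have "initial v n \<in> ?A" using n by (auto simp: take_initial)
    moreover have "v \<in> cylinder I (initial v n)" using v by (simp add: cylinder_iff)
    ultimately show "v \<in> (\<Union>u\<in>?A. cylinder I u)" by blast
  qed
next
  fix u v assume uv: "u \<in> ?A" "v \<in> ?A" "u \<noteq> v"
  have *: "length v \<le> length u" if "x \<in> cylinder I u" "x \<in> cylinder I v" "u \<in> ?A" "v \<in> ?A" for x u v
  proof (rule ccontr)
    assume "\<not> length v \<le> length u"
    then have "take (length u) v = u" "length u < length v"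
      using that(1,2) take_initial[of "length u" "length v" x] by (auto simp: cylinder_iff)
    then show False using that(3,4) by (metis (lifting) mem_Collect_eq)
  qed
  show "cylinder I u \<inter> cylinder I v = {}"
  proof (rule ccontr)
    assume "cylinder I u \<inter> cylinder I v \<noteq> {}"
    then obtain x where x: "x \<in> cylinder I u" "x \<in> cylinder I v" by blast
    then have "length u = length v" using *[of x u v] *[of x v u] uv by simp
    then show False using x uv(3) by (auto simp: cylinder_iff)
  qed
qed (use assms(1) in auto)

text \<open>If one word were a prefix of the other, an infinite word extending the longer one would lie in
  both cylinders.\<close>

lemma cut_set_branching:
  assumes "cut_set I A" shows "pairwise branching A"
proof -
  have *: "branching u v" if uv: "u \<in> A" "v \<in> A" "u \<noteq> v" and le: "length u \<le> length v" for u v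
  proof (rule ccontr)
    assume nb: "\<not> branching u v"
    have "A \<subseteq> all_words I" using assms by (simp add: cut_set_def)
    then have "admissible 1 v" using uv(2) all_words_iff by blast
    then obtain x where x: "x \<in> cylinder I v" using extend_word by blast
    have "x j = u ! j" if j: "j < length u" for j
    proof -
      have "j < length v" using j le by simp
      moreover from this have "x j = v ! j" using x by (simp add: cylinder_def)
      ultimately show ?thesis using nb j unfolding branching_def by metis
    qed
    then have "x \<in> cylinder I u" using x by (simp add: cylinder_def)
    moreover have "cylinder I u \<inter> cylinder I v = {}"
      using assms uv by (simp add: cut_set_def)
    ultimately show False using x by blast
  qed
  have sym: "branching v u \<Longrightarrow> branching u v" for u v by (auto simp: branching_def)
  show ?thesis
  proof (rule pairwiseI)
    fix u v assume "u \<in> A" "v \<in> A" "u \<noteq> v"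
    then show "branching u v"
      using *[of u v] *[of v u] sym[of v u] by (cases "length u \<le> length v") auto
  qed
qed

lemma infinite_words_nonempty: "infinite_words I \<noteq> {}"
proof -
  obtain v where "v \<in> cylinder I []" using extend_word[OF admissible_Nil] .
  then show ?thesis unfolding cylinder_iff by blast
qed

lemma cut_sets_facts:
  assumes "A \<in> cut_sets I J \<psi> \<delta> \<theta>" "\<delta> > 0"
  shows cut_sets_admissible: "u \<in> A \<Longrightarrow> admissible 1 u"
    and cut_sets_nonempty: "A \<noteq> {}"
    and cut_sets_finite: "finite A"
proof -
  have cut: "A \<subseteq> all_words I" "infinite_words I \<subseteq> (\<Union>u\<in>A. cylinder I u)"
    using assms(1) by (simp_all add: cut_sets_def cut_set_def)
  show adm: "u \<in> A \<Longrightarrow> admissible 1 u" for u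
    using cut(1) all_words_iff by blast
  show "A \<noteq> {}" using cut(2) infinite_words_nonempty by blast
  have "A \<subseteq> {u. admissible 1 u \<and> \<delta> powr (1 / \<theta>) < N (butlast u)}"
    using assms adm by (auto simp: cut_sets_def)
  then show "finite A" using finite_large_norm[of "\<delta> powr (1 / \<theta>)"] assms(2) finite_subset by auto
qed

lemma stopping_cut_set:
  assumes "0 < \<delta>" "\<delta> < 1"
  obtains A where "cut_set I A" "\<And>u. u \<in> A \<Longrightarrow> N u \<le> \<delta> \<and> \<delta> < N (butlast u)"
proof -
  let ?S = "{u. admissible 1 u \<and> N u \<le> \<delta> \<and> \<delta> < N (butlast u)}"
  have cut: "cut_set I {u \<in> ?S. \<forall>n<length u. take n u \<notin> ?S}"
  proof (rule minimal_words_cut_set)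
    fix v assume v: "v \<in> infinite_words I"
    show "\<exists>n. initial v n \<in> ?S" 
      using stopping_word[OF v assms] admissible_initial[OF v] by (metis (mono_tags, lifting) mem_Collect_eq)
  qed (auto simp: all_words_iff)
  show ?thesis by (rule that[OF cut]) auto
qed

lemma powr_inverse_theta_le:
  assumes "0 < \<delta>" "\<delta> \<le> 1" "0 < \<theta>" "\<theta> \<le> (1::real)"
  shows "\<delta> powr (1 / \<theta>) \<le> \<delta>"
proof -
  have "\<delta> powr (1 / \<theta>) \<le> \<delta> powr 1" by (rule powr_mono') (use assms in auto)
  then show ?thesis using assms(1) by simp
qed

lemma stopping_in_cut_sets:
  assumes "0 < \<delta>" "\<delta> < 1" "0 < \<theta>" "\<theta> \<le> 1"
    "cut_set I A" "\<And>u. u \<in> A \<Longrightarrow> N u \<le> \<delta> \<and> \<delta> < N (butlast u)"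
  shows "A \<in> cut_sets I J \<psi> \<delta> \<theta>"
proof -
  have "\<delta> powr (1 / \<theta>) \<le> \<delta>" by (rule powr_inverse_theta_le) (use assms in auto)
  then have "\<delta> powr (1 / \<theta>) < N (butlast u) \<and> N u \<le> \<delta>" if "u \<in> A" for u
    using assms(6)[OF that] by simp
  then show ?thesis using assms(5) by (simp add: cut_sets_def)
qed

section \<open>Pressures\<close>

abbreviation least_cut_sum :: "real \<Rightarrow> real \<Rightarrow> real \<Rightarrow> real" where
  "least_cut_sum t \<theta> \<delta> \<equiv> (INF A\<in>cut_sets I J \<psi> \<delta> \<theta>. \<Sum>u\<in>A. N u powr t)"

text \<open>Positivity is essential: since \<open>ln 0 = 0\<close>, a vanishing infimum would give the pressure term the
  value 0 instead of minus infinity.  It holds because all members of the relevant cut sets come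
  from one finite set of words.\<close>

lemma least_cut_sum_bounds:
  assumes "A \<in> cut_sets I J \<psi> \<delta> \<theta>" "\<delta> > 0"
  shows "0 < least_cut_sum t \<theta> \<delta>" "least_cut_sum t \<theta> \<delta> \<le> (\<Sum>u\<in>A. N u powr t)"
proof -
  let ?W = "{u. admissible 1 u \<and> \<delta> powr (1 / \<theta>) < N (butlast u)}"
  define m where "m = Min ((\<lambda>u. N u powr t) ` ?W)"
  have fin: "finite ?W" using finite_large_norm[of "\<delta> powr (1 / \<theta>)"] assms(2) by simp
  have W: "B \<subseteq> ?W" if "B \<in> cut_sets I J \<psi> \<delta> \<theta>" for B
    using that cut_sets_admissible[OF that assms(2)] by (auto simp: cut_sets_def)
  have ne: "?W \<noteq> {}" using W[OF assms(1)] cut_sets_nonempty[OF assms] by blast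
  have m: "m > 0" unfolding m_def using fin ne N_pos by (subst Min_gr_iff) fastforce+
  have low: "m \<le> (\<Sum>u\<in>B. N u powr t)" if B: "B \<in> cut_sets I J \<psi> \<delta> \<theta>" for B
  proof -
    obtain w where w: "w \<in> B" using cut_sets_nonempty[OF B assms(2)] by blast
    have "m \<le> N w powr t" unfolding m_def using fin w W[OF B] by (intro Min_le) auto
    also have "\<dots> \<le> (\<Sum>u\<in>B. N u powr t)"
      by (rule member_le_sum[OF w _ cut_sets_finite[OF B assms(2)]]) simp
    finally show ?thesis .
  qed
  have "m \<le> least_cut_sum t \<theta> \<delta>" using low assms(1) by (intro cINF_greatest) auto
  then show "0 < least_cut_sum t \<theta> \<delta>" using m by simp
  show "least_cut_sum t \<theta> \<delta> \<le> (\<Sum>u\<in>A. N u powr t)"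
    by (rule cINF_lower[OF _ assms(1)]) (use low in \<open>auto intro!: bdd_belowI2\<close>)
qed

lemma k_delta_word:
  assumes "0 < \<delta>" "\<delta> < 1"
  obtains u where "admissible 1 u" "length u = k_delta I J \<psi> \<delta>" "N u \<le> \<delta>" "\<delta> < N (butlast u)"
proof -
  obtain v where v: "v \<in> infinite_words I" using infinite_words_nonempty by blast
  obtain n where "N (initial v n) \<le> \<delta>" "\<delta> < N (butlast (initial v n))"
    using stopping_word[OF v assms] .
  moreover have "initial v n \<in> all_words I" using admissible_initial[OF v] all_words_iff by blast
  ultimately have "\<exists>k. \<exists>u\<in>all_words I. k = length u \<and> N u \<le> \<delta> \<and> \<delta> < N (butlast u)"
    by blast
  then have "\<exists>u\<in>all_words I. k_delta I J \<psi> \<delta> = length u \<and> N u \<le> \<delta> \<and> \<delta> < N (butlast u)"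
    unfolding k_delta_def by (rule LeastI_ex)
  then show ?thesis using that all_words_iff by metis
qed

lemma k_delta_at_top: "filterlim (\<lambda>\<delta>. k_delta I J \<psi> \<delta>) at_top (at_right 0)"
  unfolding filterlim_at_top
proof
  fix n :: nat
  obtain \<rho> where \<rho>: "\<rho> > 0" "\<And>u. admissible 1 u \<Longrightarrow> N u \<le> \<rho> \<Longrightarrow> n < length u"
    using length_gt_of_small_norm by metis
  have "n \<le> k_delta I J \<psi> \<delta>" if "0 < \<delta>" "\<delta> < min \<rho> 1" for \<delta>
    using k_delta_word[of \<delta>] \<rho>(2) that by (smt (verit) less_imp_le_nat)
  then show "\<forall>\<^sub>F \<delta> in at_right 0. n \<le> k_delta I J \<psi> \<delta>"
    unfolding eventually_at_right_field using \<rho>(1) by (intro exI[of _ "min \<rho> 1"]) auto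
qed

text \<open>The scale \<open>\<delta>\<close> is smaller than the norm of a word of length \<open>k_delta - 1\<close>, and such norms decay
  exponentially.  Hence \<open>k_delta\<close> grows at most like the logarithm of \<open>1 / \<delta>\<close>.\<close>

lemma k_delta_le_ln:
  obtains a D where "a > 0" 
    "\<And>\<delta>. 0 < \<delta> \<Longrightarrow> \<delta> < 1 \<Longrightarrow> a * real (k_delta I J \<psi> \<delta>) \<le> D - ln \<delta>"
proof -
  obtain C c where C: "C \<ge> 1" "0 < c" "c < 1" "\<And>u. admissible 1 u \<Longrightarrow> N u \<le> C * c ^ length u"
    using N_decay by metis
  show ?thesis
  proof (rule that[of "- ln c" "ln C - ln c"])
    fix \<delta> :: real assume \<delta>: "0 < \<delta>" "\<delta> < 1"
    obtain u where u: "admissible 1 u" "length u = k_delta I J \<psi> \<delta>" "N u \<le> \<delta>" "\<delta> < N (butlast u)"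
      using k_delta_word[OF \<delta>] .
    have "u \<noteq> []" using u(3,4) by auto
    then have l: "Suc (length (butlast u)) = k_delta I J \<psi> \<delta>" using u(2) by (cases u) auto
    have "\<delta> \<le> C * c ^ length (butlast u)"
      using C(4)[of "butlast u"] u(1,4) admissible_take by (force simp: butlast_conv_take)
    then have "ln \<delta> \<le> ln (C * c ^ length (butlast u))" using \<delta> C by (subst ln_le_cancel_iff) auto
    also have "\<dots> = ln C + real (length (butlast u)) * ln c"
      using C by (simp add: ln_mult ln_realpow)
    also have "real (length (butlast u)) = real (k_delta I J \<psi> \<delta>) - 1" using l by linarith
    finally show "- ln c * real (k_delta I J \<psi> \<delta>) \<le> ln C - ln c - ln \<delta>" by (simp add: algebra_simps)
  qed (use C in simp)
qed

text \<open>A sum of order \<open>\<delta> powr \<eta>\<close> has logarithm at most a constant minus \<open>\<eta> * a * k_delta\<close>, with the positive rate \<open>a\<close>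
  from the bound on \<open>k_delta\<close>; dividing
  by \<open>k_delta\<close> and giving up half of the rate absorbs the constant.\<close>

lemma pressure_term_le:
  assumes "\<eta> > 0" "M > 0"
  obtains \<zeta> \<delta>0 where "\<zeta> > 0" "\<delta>0 > 0"
    "\<And>\<delta> A \<theta> t. 0 < \<delta> \<Longrightarrow> \<delta> < \<delta>0 \<Longrightarrow> A \<in> cut_sets I J \<psi> \<delta> \<theta> \<Longrightarrow>
       (\<Sum>u\<in>A. N u powr t) \<le> M * \<delta> powr \<eta> \<Longrightarrow> pressure_term I J \<psi> t \<theta> \<delta> \<le> - \<zeta>"
proof -
  obtain a D where a: "a > 0" 
    "\<And>\<delta>. 0 < \<delta> \<Longrightarrow> \<delta> < 1 \<Longrightarrow> a * real (k_delta I J \<psi> \<delta>) \<le> D - ln \<delta>"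
    using k_delta_le_ln by metis
  \<comment> \<open>Half of the rate \<open>\<eta> * a\<close>; the other half absorbs the constant \<open>ln M + \<eta> * D\<close> once \<open>k_delta \<ge> m\<close>.\<close>
  define \<zeta> where "\<zeta> = \<eta> * a / 2"
  have \<zeta>: "\<zeta> > 0" using assms a(1) by (simp add: \<zeta>_def)
  obtain m :: nat where "(ln M + \<eta> * D) / \<zeta> < real m" using reals_Archimedean2 by blast
  then have m: "ln M + \<eta> * D \<le> \<zeta> * real m" using \<zeta> by (simp add: field_simps)
  obtain \<rho> where \<rho>: "\<rho> > 0" "\<And>u. admissible 1 u \<Longrightarrow> N u \<le> \<rho> \<Longrightarrow> m < length u"
    using length_gt_of_small_norm by metis
  show ?thesis
  proof (rule that[OF \<zeta>, of "min \<rho> 1"])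
    fix \<delta> A \<theta> t assume \<delta>: "0 < \<delta>" "\<delta> < min \<rho> 1" and A: "A \<in> cut_sets I J \<psi> \<delta> \<theta>"
      and le: "(\<Sum>u\<in>A. N u powr t) \<le> M * \<delta> powr \<eta>"
    let ?k = "k_delta I J \<psi> \<delta>"
    obtain u where u: "admissible 1 u" "length u = ?k" "N u \<le> \<delta>"
      using k_delta_word[of \<delta>] \<delta> by auto
    then have k: "m < ?k" using \<rho>(2)[of u] \<delta> by simp
    have "ln (least_cut_sum t \<theta> \<delta>) \<le> ln (M * \<delta> powr \<eta>)"
      using least_cut_sum_bounds[OF A \<delta>(1), of t] le by simp
    also have "\<dots> = ln M + \<eta> * ln \<delta>" using assms \<delta> by (simp add: ln_mult ln_powr)
    also have "\<dots> \<le> ln M + \<eta> * (D - a * real ?k)"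
      using a(2)[of \<delta>] \<delta> assms(1) by simp
    also have "\<dots> = (ln M + \<eta> * D) - 2 * \<zeta> * real ?k" by (simp add: \<zeta>_def algebra_simps)
    also have "\<dots> \<le> - \<zeta> * real ?k"
    proof -
      have "\<zeta> * real m \<le> \<zeta> * real ?k" using k \<zeta> by simp
      then show ?thesis using m by simp
    qed
    finally have "1 / real ?k * ln (least_cut_sum t \<theta> \<delta>) \<le> 1 / real ?k * (- \<zeta> * real ?k)"
      by (rule mult_left_mono) simp
    also have "\<dots> = - \<zeta>" using k by simp
    finally show "pressure_term I J \<psi> t \<theta> \<delta> \<le> - \<zeta>" unfolding pressure_term_def .
  qed (use \<rho> in simp)
qed

text \<open>Each summand is at least 1 for \<open>t \<le> 0\<close>.  Hence the infima that define the critical exponents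
  run over positive reals.\<close>

lemma pressure_term_nonneg:
  assumes "t \<le> 0" "0 < \<theta>" "\<theta> \<le> 1" "0 < \<delta>" "\<delta> < 1"
  shows "0 \<le> pressure_term I J \<psi> t \<theta> \<delta>"
proof -
  obtain A0 where A0: "cut_set I A0" "\<And>u. u \<in> A0 \<Longrightarrow> N u \<le> \<delta> \<and> \<delta> < N (butlast u)"
    using stopping_cut_set[OF assms(4,5)] by metis
  have ne: "cut_sets I J \<psi> \<delta> \<theta> \<noteq> {}" using stopping_in_cut_sets[OF assms(4,5,2,3) A0] by auto
  have "1 \<le> (\<Sum>u\<in>A. N u powr t)" if A: "A \<in> cut_sets I J \<psi> \<delta> \<theta>" for A
  proof -
    obtain w where w: "w \<in> A" using cut_sets_nonempty[OF A assms(4)] by blast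
    have "N w \<le> 1" using A w assms(5) by (auto simp: cut_sets_def)
    moreover have "N w > 0" using N_pos cut_sets_admissible[OF A assms(4) w] by blast
    ultimately have "1 \<le> N w powr t" using powr_mono'[of t 0 "N w"] assms(1) by simp
    also have "\<dots> \<le> (\<Sum>u\<in>A. N u powr t)"
      by (rule member_le_sum[OF w _ cut_sets_finite[OF A assms(4)]]) simp
    finally show ?thesis .
  qed
  then have "1 \<le> least_cut_sum t \<theta> \<delta>" using ne by (intro cINF_greatest) auto
  then show ?thesis unfolding pressure_term_def by simp
qed

lemma sum_lt_of_pressure_term:
  assumes "pressure_term I J \<psi> t \<theta> \<delta> < - \<zeta>" "0 < \<zeta>" "0 < \<theta>" "\<theta> \<le> 1" "0 < \<delta>" "\<delta> < 1"
  obtains A where "A \<in> cut_sets I J \<psi> \<delta> \<theta>"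
    "(\<Sum>u\<in>A. N u powr t) < exp (- \<zeta> * real (k_delta I J \<psi> \<delta>))"
proof -
  let ?k = "real (k_delta I J \<psi> \<delta>)"
  obtain A0 where A0: "cut_set I A0" "\<And>u. u \<in> A0 \<Longrightarrow> N u \<le> \<delta> \<and> \<delta> < N (butlast u)"
    using stopping_cut_set[OF assms(5,6)] by blast
  have A0': "A0 \<in> cut_sets I J \<psi> \<delta> \<theta>" using stopping_in_cut_sets[OF assms(5,6,3,4) A0] .
  have "?k \<noteq> 0" using assms(1,2) by (intro notI) (simp add: pressure_term_def)
  then have k: "?k > 0" by simp
  have "1 / ?k * ln (least_cut_sum t \<theta> \<delta>) < - \<zeta>" using assms(1) unfolding pressure_term_def .
  then have "ln (least_cut_sum t \<theta> \<delta>) / ?k < - \<zeta>" by (metis mult_1 times_divide_eq_left)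
  then have "ln (least_cut_sum t \<theta> \<delta>) < - \<zeta> * ?k" using k by (rule pos_divide_less_eq[THEN iffD1, rotated])
  then have "least_cut_sum t \<theta> \<delta> < exp (- \<zeta> * ?k)"
    using least_cut_sum_bounds(1)[OF A0' assms(5), of t] exp_less_mono exp_ln by metis
  then have "\<exists>A\<in>cut_sets I J \<psi> \<delta> \<theta>. (\<Sum>u\<in>A. N u powr t) < exp (- \<zeta> * ?k)"
    using cInf_lessD[of "(\<lambda>A. \<Sum>u\<in>A. N u powr t) ` cut_sets I J \<psi> \<delta> \<theta>" "exp (- \<zeta> * ?k)"] A0'
    by fastforce
  then show ?thesis using that by blast
qed

lemma upper_pressure_negD:
  assumes "upper_pressure I J \<psi> t \<theta> < 0"
  obtains \<zeta> where "\<zeta> > 0" "\<forall>\<^sub>F \<delta> in at_right 0. pressure_term I J \<psi> t \<theta> \<delta> < - \<zeta>"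
proof -
  obtain z where z: "upper_pressure I J \<psi> t \<theta> < ereal z" "ereal z < 0"
    using ereal_dense2[OF assms] by blast
  have "\<forall>\<^sub>F \<delta> in at_right 0. ereal (pressure_term I J \<psi> t \<theta> \<delta>) < ereal z"
    using z(1) unfolding upper_pressure_def by (rule Limsup_lessD)
  then show ?thesis using that[of "- z"] z(2) by simp
qed

lemma lower_pressure_negD:
  assumes "lower_pressure I J \<psi> t \<theta> < 0"
  obtains \<zeta> where "\<zeta> > 0" "\<exists>\<^sub>F \<delta> in at_right 0. pressure_term I J \<psi> t \<theta> \<delta> < - \<zeta>"
proof -
  obtain z where z: "lower_pressure I J \<psi> t \<theta> < ereal z" "ereal z < 0"
    using ereal_dense2[OF assms] by blast
  have "\<exists>\<^sub>F \<delta> in at_right 0. pressure_term I J \<psi> t \<theta> \<delta> < z"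
  proof (rule ccontr)
    assume "\<not> ?thesis"
    then have "\<forall>\<^sub>F \<delta> in at_right 0. ereal z \<le> ereal (pressure_term I J \<psi> t \<theta> \<delta>)"
      by (simp add: not_frequently not_less)
    then have "ereal z \<le> lower_pressure I J \<psi> t \<theta>"
      unfolding lower_pressure_def by (rule Liminf_bounded)
    then show False using z(1) by simp
  qed
  then show ?thesis using that[of "- z"] z(2) by simp
qed

lemma upper_pressure_negI:
  assumes "\<zeta> > 0" "\<forall>\<^sub>F \<delta> in at_right 0. pressure_term I J \<psi> t \<theta> \<delta> \<le> - \<zeta>"
  shows "upper_pressure I J \<psi> t \<theta> < 0"
proof -
  have "upper_pressure I J \<psi> t \<theta> \<le> ereal (- \<zeta>)"
    unfolding upper_pressure_def by (rule Limsup_bounded) (use assms(2) in simp)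
  also have "\<dots> < 0" using assms(1) by simp
  finally show ?thesis .
qed

lemma lower_pressure_negI:
  assumes "\<zeta> > 0" "\<exists>\<^sub>F \<delta> in at_right 0. pressure_term I J \<psi> t \<theta> \<delta> \<le> - \<zeta>"
  shows "lower_pressure I J \<psi> t \<theta> < 0"
proof (rule ccontr)
  assume "\<not> ?thesis"
  then have "0 \<le> lower_pressure I J \<psi> t \<theta>" by (simp only: not_less)
  moreover have "ereal (- \<zeta>) < 0" using assms(1) by simp
  ultimately have "ereal (- \<zeta>) < lower_pressure I J \<psi> t \<theta>" by order
  then have "\<forall>\<^sub>F \<delta> in at_right 0. ereal (- \<zeta>) < ereal (pressure_term I J \<psi> t \<theta> \<delta>)"
    unfolding lower_pressure_def by (rule less_LiminfD)
  then show False using assms(2) by (simp add: frequently_def not_le)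
qed

section \<open>Comparing a word with its parent\<close>

text \<open>With \<open>\<epsilon> = 1 - 1 / \<gamma>\<close>, the hypothesis gives for large \<open>k\<close> that the smallest ratio at level \<open>k\<close>
  is at least \<open>max_norm k powr \<epsilon>\<close>, hence at least \<open>N u powr \<epsilon>\<close> for a word \<open>u\<close> of length \<open>k\<close>.
  So \<open>N (butlast u) * N u powr \<epsilon>\<close> is at most a constant times \<open>N u\<close>, and raising to the
  power \<open>\<gamma>\<close> gives the claim.\<close>

lemma norm_butlast_powr_le:
  assumes lim: "(\<lambda>k. ln (min_ratio I J \<psi> k) / ln (max_norm I J \<psi> k)) \<longlonglongrightarrow> 0"
    and \<gamma>: "\<gamma> > 1"
  obtains B n where "B > 0"
    "\<And>u. admissible 1 u \<Longrightarrow> n < length u \<Longrightarrow> N (butlast u) powr \<gamma> \<le> B * N u"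
proof -
  define \<epsilon> where "\<epsilon> = 1 - 1 / \<gamma>"
  have \<epsilon>: "\<epsilon> > 0" using \<gamma> by (simp add: \<epsilon>_def)
  obtain B where B: "B > 0" "\<And>u i. admissible 1 (u @ [i]) \<Longrightarrow>
       N u * deriv_norm J (\<psi> (Suc (length u)) i) \<le> B * N (u @ [i])"
    using N_snoc_ge by metis
  obtain n1 where n1: "\<And>k. k \<ge> n1 \<Longrightarrow> ln (min_ratio I J \<psi> k) / ln (max_norm I J \<psi> k) < \<epsilon>"
    using order_tendstoD(2)[OF lim \<epsilon>] unfolding eventually_sequentially by blast
  \<comment> \<open>Beyond length \<open>n2\<close> all norms are at most 1/2, so the logarithm of \<open>max_norm\<close> is negative.\<close>
  obtain n2 where n2: "\<And>u. admissible 1 u \<Longrightarrow> 1 / 2 < N u \<Longrightarrow> length u < n2"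
    using length_bound_of_norm[of "1/2"] by auto
  define n where "n = n1 + n2"
  show ?thesis
  proof (rule that[of "B powr \<gamma>" n])
    fix u assume u: "admissible 1 u" "n < length u"
    define k where "k = length u"
    have ne: "u \<noteq> []" using u(2) by auto
    have ui: "butlast u @ [last u] = u" using ne by simp
    have len: "Suc (length (butlast u)) = k" using ne by (simp add: k_def)
    have b: "admissible 1 (butlast u)" using u(1) by (simp add: butlast_conv_take admissible_take)
    have lastI: "last u \<in> I k" using u(1) ui len by (metis admissible_append admissible_Cons plus_1_eq_Suc)
    have uw: "u \<in> words I k" using u(1) by (simp add: words_iff k_def)
    have Mu: "N u \<le> max_norm I J \<psi> k"
      unfolding max_norm_def using finite_words by (intro cSUP_upper[OF uw]) auto
    have "max_norm I J \<psi> k \<le> 1 / 2"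
      unfolding max_norm_def
    proof (rule cSUP_least)
      fix w assume "w \<in> words I k"
      then have "admissible 1 w" "\<not> length w < n2" using u(2) by (auto simp: words_iff k_def n_def)
      then show "N w \<le> 1 / 2" using n2 by force
    qed (use uw in auto)
    then have lnM: "ln (max_norm I J \<psi> k) < 0" using Mu N_pos[OF u(1)] by (intro ln_less_zero) auto
    have c: "0 < min_ratio I J \<psi> k" "min_ratio I J \<psi> k \<le> deriv_norm J (\<psi> k (last u))"
    proof -
      have k1: "k \<ge> 1" using len by simp
      have img: "finite ((\<lambda>j. deriv_norm J (\<psi> k j)) ` I k)" "(\<lambda>j. deriv_norm J (\<psi> k j)) ` I k \<noteq> {}"
        using finite_I[OF k1] I_nonempty[OF k1] by auto
      have "0 < deriv_norm J (\<psi> k j)" if "j \<in> I k" for j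
        using deriv_norm_pos[of k "[j]"] that k1 by simp
      then have "0 < Min ((\<lambda>j. deriv_norm J (\<psi> k j)) ` I k)" using img by (subst Min_gr_iff) auto
      then show "0 < min_ratio I J \<psi> k" unfolding min_ratio_def using cInf_eq_Min[OF img] by simp
      show "min_ratio I J \<psi> k \<le> deriv_norm J (\<psi> k (last u))"
        unfolding min_ratio_def using img(1) by (intro cINF_lower[OF _ lastI]) auto
    qed
    have "ln (min_ratio I J \<psi> k) / ln (max_norm I J \<psi> k) < \<epsilon>"
      using n1 u(2) by (simp add: k_def n_def)
    then have "\<epsilon> * ln (max_norm I J \<psi> k) < ln (min_ratio I J \<psi> k)"
      using lnM by (simp add: neg_divide_less_eq)
    moreover have "\<epsilon> * ln (N u) \<le> \<epsilon> * ln (max_norm I J \<psi> k)"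
      using Mu N_pos[OF u(1)] \<epsilon> by (intro mult_left_mono) auto
    ultimately have "ln (N u powr \<epsilon>) \<le> ln (min_ratio I J \<psi> k)"
      by (simp add: ln_powr)
    then have "N u powr \<epsilon> \<le> min_ratio I J \<psi> k"
      using c(1) N_pos[OF u(1)] by (subst (asm) ln_le_cancel_iff) auto
    then have "N (butlast u) * N u powr \<epsilon> \<le> N (butlast u) * deriv_norm J (\<psi> k (last u))"
      using c(2) N_pos[OF b] by (intro mult_left_mono) auto
    also have "\<dots> \<le> B * N u" using B(2)[of "butlast u" "last u"] u(1) ui len by simp
    also have "\<dots> = B * (N u powr \<epsilon> * N u powr (1 / \<gamma>))"
      using N_pos[OF u(1)] by (simp add: \<epsilon>_def flip: powr_add)
    finally have "N (butlast u) \<le> B * N u powr (1 / \<gamma>)" using N_pos[OF u(1)] by (simp add: mult_ac)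
    then have "N (butlast u) powr \<gamma> \<le> (B * N u powr (1 / \<gamma>)) powr \<gamma>"
      using N_pos[OF b] \<gamma> by (intro powr_mono2) auto
    also have "\<dots> = B powr \<gamma> * N u"
      using B(1) N_pos[OF u(1)] \<gamma> by (simp add: powr_mult powr_powr)
    finally show "N (butlast u) powr \<gamma> \<le> B powr \<gamma> * N u" .
  qed (use B in simp)
qed

section \<open>Covers of the attractor and cut sets\<close>

lemma Jw_nonempty: "admissible 1 u \<Longrightarrow> Jw u \<noteq> {}"
  by (rule Jw_eq) (use J_nonempty in auto)

text \<open>A point of the attractor lies in a basic set of a word longer than all members of the cut set; one
  of these members is a prefix of that word.\<close>

lemma attractor_subset_cut_set:
  assumes "cut_set I A" "finite A"
  shows "attractor I Jw \<subseteq> (\<Union>u\<in>A. Jw u)"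
proof
  fix x assume x: "x \<in> attractor I Jw"
  \<comment> \<open>The successor makes \<open>n\<close> positive: the intersection defining the attractor starts at level 1.\<close>
  define n where "n = Suc (Max (length ` A))"
  have n: "length u \<le> n" if "u \<in> A" for u
    using Max_ge[of "length ` A" "length u"] that assms(2) by (simp add: n_def le_SucI)
  obtain w where w: "w \<in> words I n" "x \<in> Jw w"
    using x unfolding attractor_def by (auto simp: n_def)
  then have adm: "admissible 1 w" "length w = n" by (auto simp: words_iff)
  obtain v where v: "v \<in> cylinder I w" using extend_word[OF adm(1)] .
  then have vi: "v \<in> infinite_words I" "initial v n = w" using adm(2) by (auto simp: cylinder_iff)
  have "infinite_words I \<subseteq> (\<Union>u\<in>A. cylinder I u)" using assms(1) by (simp add: cut_set_def)
  then obtain u where u: "u \<in> A" "v \<in> cylinder I u" using vi(1) by blast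
  then have "u = take (length u) w" using take_initial[OF n[OF u(1)], of v] vi by (simp add: cylinder_iff)
  then have "Jw w \<subseteq> Jw u" using Jw_subset_take[OF adm(1), of "length u"] by simp
  then show "x \<in> (\<Union>u\<in>A. Jw u)" using w(2) u(1) by blast
qed

lemma attractor_point:
  assumes v: "v \<in> infinite_words I"
  obtains x where "x \<in> attractor I Jw" "\<And>n. x \<in> Jw (initial v n)"
proof -
  note adm = admissible_initial[OF v]
  have "\<Inter> (range (\<lambda>n. Jw (initial v n))) \<noteq> {}"
  proof (rule compact_nest)
    fix n
    have "\<forall>u\<in>all_words I. closed (Jw u) \<and> Jw u \<subseteq> J" using ifs by (simp add: nonautonomous_ifs_def)
    then have "closed (Jw (initial v n))" "Jw (initial v n) \<subseteq> J" using adm all_words_iff by blast+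
    then show "compact (Jw (initial v n))" using compact_J by (metis compact_Int_closed inf.absorb_iff2)
    show "Jw (initial v n) \<noteq> {}" using Jw_nonempty adm by blast
  next
    fix m n :: nat assume "m \<le> n"
    then show "Jw (initial v n) \<subseteq> Jw (initial v m)"
      using Jw_subset_take[OF adm, of n m] by (simp add: take_initial)
  qed
  then obtain x where x: "\<And>n. x \<in> Jw (initial v n)" by blast
  have w: "initial v k \<in> words I k" for k using adm by (simp add: words_iff)
  have "x \<in> attractor I Jw" unfolding attractor_def using x w by blast
  then show ?thesis using that x by blast
qed

text \<open>The member \<open>u\<close> of the cut set contributes a ball of diameter \<open>L * N u\<close> or, if that is too small,
  of the smallest permitted diameter.  In the second case the diameter is comparable with
  \<open>\<delta> powr (1 / \<theta>)\<close>, which is less than \<open>N (butlast u)\<close>, so the comparison of a word with its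
  parent bounds its power \<open>s\<close> by a multiple of \<open>N u powr t\<close>.  Balls are used since their diameter is
  known exactly: for \<open>\<theta> = 1\<close> only one diameter is permitted.\<close>

lemma cover_of_cut_set:
  assumes lim: "(\<lambda>k. ln (min_ratio I J \<psi> k) / ln (max_norm I J \<psi> k)) \<longlonglongrightarrow> 0"
    and \<theta>: "0 < \<theta>" "\<theta> \<le> 1" and st: "0 < t" "t < s"
  obtains L B \<delta>0 where "L > 0" "B > 0" "\<delta>0 > 0"
    "\<And>\<delta> A. 0 < \<delta> \<Longrightarrow> \<delta> < \<delta>0 \<Longrightarrow> A \<in> cut_sets I J \<psi> \<delta> \<theta> \<Longrightarrow>
       \<exists>U. admissible_cover (attractor I Jw) \<theta> (L * \<delta>) U \<and>
         (\<Sum>\<^sub>\<infinity>X\<in>U. diam_powr s X) \<le> ennreal (B * (\<Sum>u\<in>A. N u powr t))"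
proof -
  obtain K where K: "K > 0"
    "\<And>u x y. admissible 1 u \<Longrightarrow> x \<in> Jw u \<Longrightarrow> y \<in> Jw u \<Longrightarrow> dist x y \<le> K * N u"
    using Jw_dist_le by metis
  \<comment> \<open>Raising \<open>N (butlast u) powr (s / t) \<le> B1 * N u\<close> to the power \<open>t\<close> compares the exponents \<open>s\<close> and \<open>t\<close>.\<close>
  have \<gamma>: "1 < s / t" using st by simp
  obtain B1 n where B1: "B1 > 0"
    "\<And>u. admissible 1 u \<Longrightarrow> n < length u \<Longrightarrow> N (butlast u) powr (s / t) \<le> B1 * N u"
    using norm_butlast_powr_le[OF lim \<gamma>] by metis
  obtain \<rho> where \<rho>: "\<rho> > 0" "\<And>u. admissible 1 u \<Longrightarrow> N u \<le> \<rho> \<Longrightarrow> n < length u"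
    using length_gt_of_small_norm by metis
  define L where "L = 2 * K"
  have L: "L > 0" using K by (simp add: L_def)
  define B where "B = L powr s + (L powr (1 / \<theta>)) powr s * B1 powr t"
  have B: "B > 0" unfolding B_def using L B1(1) by (simp add: add_pos_pos)
  \<comment> \<open>Below \<open>\<rho>\<close> all words of the cut set are long; below \<open>1 / L\<close> the smallest permitted diameter at scale
    \<open>L * \<delta>\<close> is at most \<open>L * \<delta>\<close>.\<close>
  define \<delta>0 where "\<delta>0 = Min {\<rho>, 1, 1 / L}"
  show ?thesis
  proof (rule that[OF L B, of \<delta>0])
    show "\<delta>0 > 0" using \<rho> L by (simp add: \<delta>0_def)
  next
    fix \<delta> A assume \<delta>: "0 < \<delta>" "\<delta> < \<delta>0" and A: "A \<in> cut_sets I J \<psi> \<delta> \<theta>"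
    have \<delta>': "\<delta> < \<rho>" "\<delta> < 1" "L * \<delta> \<le> 1" using \<delta> L by (auto simp: \<delta>0_def field_simps)
    note adm = cut_sets_admissible[OF A \<delta>(1)] and fin = cut_sets_finite[OF A \<delta>(1)]
    have cut: "cut_set I A" and AN: "\<And>u. u \<in> A \<Longrightarrow> \<delta> powr (1 / \<theta>) < N (butlast u)"
      "\<And>u. u \<in> A \<Longrightarrow> N u \<le> \<delta>" using A by (auto simp: cut_sets_def)
    \<comment> \<open>\<open>\<rho>0\<close> is the smallest diameter permitted in a cover at scale \<open>L * \<delta>\<close>.\<close>
    define \<rho>0 where "\<rho>0 = (L * \<delta>) powr (1 / \<theta>)"
    have \<rho>0: "0 < \<rho>0" "\<rho>0 \<le> L * \<delta>"
      using powr_inverse_theta_le[of "L * \<delta>" \<theta>] \<delta>'(3) \<theta> L \<delta>(1) by (auto simp: \<rho>0_def)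
    have "\<forall>u\<in>A. \<exists>x. x \<in> Jw u" using Jw_nonempty adm by blast
    then obtain p where p: "\<And>u. u \<in> A \<Longrightarrow> p u \<in> Jw u" by metis
    define r where "r u = max (K * N u) (\<rho>0 / 2)" for u
    define U where "U = (\<lambda>u. cball (p u) (r u)) ` A"
    have r0: "r u > 0" for u using \<rho>0 by (simp add: r_def)
    have diam: "diameter (cball (p u) (r u)) = max (L * N u) \<rho>0" for u
      using r0[of u] by (simp add: r_def L_def max_def)
    have sub: "Jw u \<subseteq> cball (p u) (r u)" if u: "u \<in> A" for u
    proof
      fix y assume "y \<in> Jw u"
      then have "dist (p u) y \<le> K * N u" using K(2)[OF adm[OF u] p[OF u]] by blast
      then show "y \<in> cball (p u) (r u)" by (simp add: r_def)
    qed
    have "attractor I Jw \<subseteq> \<Union>U"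
      using attractor_subset_cut_set[OF cut fin] sub unfolding U_def by blast
    moreover have "bounded X \<and> diameter X \<le> L * \<delta> \<and> (L * \<delta>) powr (1 / \<theta>) \<le> diameter X" if X: "X \<in> U" for X
    proof -
      obtain u where u: "u \<in> A" "X = cball (p u) (r u)" using X unfolding U_def by blast
      have "L * N u \<le> L * \<delta>" using AN(2)[OF u(1)] L by simp
      then show ?thesis unfolding u(2) diam using \<rho>0 by (simp add: \<rho>0_def)
    qed
    moreover have "countable U" unfolding U_def using fin by (simp add: countable_finite)
    ultimately have "admissible_cover (attractor I Jw) \<theta> (L * \<delta>) U"
      unfolding admissible_cover_def countable_cover_def by blast
    moreover have cost: "diam_powr s (cball (p u) (r u)) \<le> ennreal (B * N u powr t)" if u: "u \<in> A" for u
    proof -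
      have Nu: "0 < N u" using N_pos adm u by blast
      have "N u powr s \<le> N u powr t" using Nu AN(2)[OF u] \<delta>'(2) st by (intro powr_mono') auto
      then have 1: "(L * N u) powr s \<le> L powr s * N u powr t"
        using L Nu by (simp add: powr_mult)
      have len: "n < length u" using \<rho>(2)[OF adm[OF u]] AN(2)[OF u] \<delta>'(1) by simp
      have "(\<delta> powr (1 / \<theta>)) powr s \<le> N (butlast u) powr s"
        using AN(1)[OF u] st by (intro powr_mono2) auto
      also have "\<dots> = (N (butlast u) powr (s / t)) powr t" using st by (simp add: powr_powr)
      also have "\<dots> \<le> (B1 * N u) powr t"
        using B1(2)[OF adm[OF u] len] st by (intro powr_mono2) auto
      also have "\<dots> = B1 powr t * N u powr t" using B1(1) Nu by (simp add: powr_mult)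
      finally have "\<rho>0 powr s \<le> (L powr (1 / \<theta>)) powr s * (B1 powr t * N u powr t)"
        using L \<delta>(1) by (simp add: \<rho>0_def powr_mult)
      moreover have "max (L * N u) \<rho>0 powr s \<le> (L * N u) powr s + \<rho>0 powr s"
        by (simp add: max_def)
      ultimately have "max (L * N u) \<rho>0 powr s \<le> B * N u powr t"
        using 1 unfolding B_def by (simp add: algebra_simps)
      then show ?thesis
        unfolding diam_powr_def diam using st r0[of u] by (simp add: ennreal_leI)
    qed
    moreover have "(\<Sum>\<^sub>\<infinity>X\<in>U. diam_powr s X) \<le> ennreal (B * (\<Sum>u\<in>A. N u powr t))"
    proof -
      have "(\<Sum>\<^sub>\<infinity>X\<in>U. diam_powr s X) = (\<Sum>X\<in>U. diam_powr s X)"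
        using fin by (simp add: U_def)
      also have "\<dots> \<le> (\<Sum>u\<in>A. diam_powr s (cball (p u) (r u)))"
        unfolding U_def using sum_image_le[OF fin, of "diam_powr s" "\<lambda>u. cball (p u) (r u)"] by simp
      also have "\<dots> \<le> (\<Sum>u\<in>A. ennreal (B * N u powr t))" using cost by (intro sum_mono)
      also have "\<dots> = ennreal (B * (\<Sum>u\<in>A. N u powr t))"
        using B by (simp add: sum_distrib_left)
      finally show ?thesis .
    qed
    ultimately show "\<exists>U. admissible_cover (attractor I Jw) \<theta> (L * \<delta>) U \<and>
         (\<Sum>\<^sub>\<infinity>X\<in>U. diam_powr s X) \<le> ennreal (B * (\<Sum>u\<in>A. N u powr t))" by blast
  qed
qed

text \<open>Along an infinite word, consider a point of the attractor in all its basic sets and a member \<open>X\<close>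
  of the cover containing it: the first prefix whose norm is at most the diameter \<open>\<rho>\<close> of \<open>X\<close> is put
  into the family.  Those belonging to one \<open>X\<close> have norms between a multiple of \<open>\<rho> powr \<gamma>\<close> and
  \<open>\<rho>\<close>, so by volume there are at most \<open>O(\<rho> powr (d - \<gamma> * d))\<close> of them, where \<open>d\<close> is the dimension
  and \<open>\<gamma> > 1\<close> is as close to 1 as desired.\<close>

lemma cut_set_of_cover:
  assumes lim: "(\<lambda>k. ln (min_ratio I J \<psi> k) / ln (max_norm I J \<psi> k)) \<longlonglongrightarrow> 0"
    and \<theta>: "0 < \<theta>" "\<theta> \<le> 1" and st: "0 \<le> s" "s < t"
  obtains M \<delta>0 where "M > 0" "\<delta>0 > 0"
    "\<And>\<delta> U. 0 < \<delta> \<Longrightarrow> \<delta> < \<delta>0 \<Longrightarrow> admissible_cover (attractor I Jw) \<theta> \<delta> U \<Longrightarrow>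
       (\<Sum>\<^sub>\<infinity>X\<in>U. diam_powr s X) \<le> 1 \<Longrightarrow>
       \<exists>A\<in>cut_sets I J \<psi> \<delta> \<theta>. (\<Sum>u\<in>A. N u powr t) \<le> M * \<delta> powr ((t - s) / 2)"
proof -
  let ?d = "DIM('a)"
  have d: "real ?d > 0" by simp
  \<comment> \<open>This choice makes the loss \<open>\<gamma> * d - d\<close> from counting equal to half of the gap between \<open>s\<close> and \<open>t\<close>.\<close>
  define \<gamma> where "\<gamma> = 1 + (t - s) / (2 * real ?d)"
  have \<gamma>: "\<gamma> > 1" "\<gamma> * real ?d = real ?d + (t - s) / 2" using st d by (auto simp: \<gamma>_def field_simps)
  obtain K where K: "K > 0"
    "\<And>u x y. admissible 1 u \<Longrightarrow> x \<in> Jw u \<Longrightarrow> y \<in> Jw u \<Longrightarrow> dist x y \<le> K * N u"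
    using Jw_dist_le by metis
  obtain \<kappa> where \<kappa>: "\<kappa> > 0" "\<And>A x R. finite A \<Longrightarrow> R \<ge> 0 \<Longrightarrow> (\<And>u. u \<in> A \<Longrightarrow> admissible 1 u) \<Longrightarrow>
     pairwise branching A \<Longrightarrow> (\<And>u. u \<in> A \<Longrightarrow> Jw u \<subseteq> cball x R) \<Longrightarrow>
     (\<Sum>u\<in>A. N u ^ ?d) \<le> (R / \<kappa>) ^ ?d"
    using sum_norm_power_le by metis
  obtain B n where B: "B > 0"
    "\<And>u. admissible 1 u \<Longrightarrow> n < length u \<Longrightarrow> N (butlast u) powr \<gamma> \<le> B * N u"
    using norm_butlast_powr_le[OF lim \<gamma>(1)] by metis
  obtain \<rho>1 where \<rho>1: "\<rho>1 > 0" "\<And>u. admissible 1 u \<Longrightarrow> N u \<le> \<rho>1 \<Longrightarrow> n < length u"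
    using length_gt_of_small_norm by metis
  define M where "M = B ^ ?d * ((1 + K) / \<kappa>) ^ ?d"
  have M: "M > 0" unfolding M_def using B(1) K(1) \<kappa>(1) by simp
  have piece: "(\<Sum>u\<in>A. N u powr t) \<le> M * \<rho> powr (s + (t - s) / 2)"
    if \<rho>: "0 < \<rho>" "\<rho> < \<rho>1" and fin: "finite A" and br: "pairwise branching A"
      and X: "bounded X" "diameter X = \<rho>" "x \<in> X"
      and A: "\<And>u. u \<in> A \<Longrightarrow> admissible 1 u \<and> N u \<le> \<rho> \<and> \<rho> < N (butlast u) \<and> Jw u \<inter> X \<noteq> {}"
    for \<rho> A X x
  proof -
    have sub: "Jw u \<subseteq> cball x ((1 + K) * \<rho>)" if u: "u \<in> A" for u
    proof
      fix y assume y: "y \<in> Jw u"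
      obtain z where z: "z \<in> Jw u" "z \<in> X" using A[OF u] by blast
      have "dist x z \<le> \<rho>" using diameter_bounded_bound[OF X(1) X(3) z(2)] X(2) by simp
      moreover have "dist z y \<le> K * N u" using K(2) A[OF u] z(1) y by blast
      moreover have "K * N u \<le> K * \<rho>" using A[OF u] K(1) by simp
      ultimately have "dist x y \<le> \<rho> + K * \<rho>" using dist_triangle[of x y z] by linarith
      then show "y \<in> cball x ((1 + K) * \<rho>)" by (simp add: algebra_simps)
    qed
    have low: "\<rho> powr \<gamma> / B \<le> N u" if u: "u \<in> A" for u
    proof -
      have "\<rho> powr \<gamma> \<le> N (butlast u) powr \<gamma>" using A[OF u] \<rho> \<gamma>(1) by (intro powr_mono2) auto
      also have "\<dots> \<le> B * N u" using B(2) \<rho>1(2) A[OF u] \<rho>(2) by force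
      finally show ?thesis using B(1) by (simp add: divide_le_eq mult.commute)
    qed
    have "real (card A) * (\<rho> powr \<gamma> / B) ^ ?d = (\<Sum>u\<in>A. (\<rho> powr \<gamma> / B) ^ ?d)" by simp
    also have "\<dots> \<le> (\<Sum>u\<in>A. N u ^ ?d)"
      using low B(1) by (intro sum_mono power_mono) auto
    also have "\<dots> \<le> ((1 + K) * \<rho> / \<kappa>) ^ ?d"
      by (rule \<kappa>(2)[OF fin _ _ br sub]) (use A K \<rho> in auto)
    also have "\<dots> = ((1 + K) / \<kappa>) ^ ?d * \<rho> powr real ?d"
      using \<rho>(1) by (simp add: powr_realpow power_mult_distrib power_divide)
    also have "(\<rho> powr \<gamma> / B) ^ ?d = \<rho> powr (\<gamma> * real ?d) / B ^ ?d"
      using \<rho>(1) by (simp add: power_divide powr_powr[symmetric] powr_realpow)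
    finally have "real (card A) * \<rho> powr (\<gamma> * real ?d) / B ^ ?d
        \<le> ((1 + K) / \<kappa>) ^ ?d * \<rho> powr real ?d" by simp
    then have "real (card A) * \<rho> powr (\<gamma> * real ?d)
        \<le> ((1 + K) / \<kappa>) ^ ?d * \<rho> powr real ?d * B ^ ?d"
      using B(1) by (subst (asm) pos_divide_le_eq) auto
    then have "real (card A) * \<rho> powr (\<gamma> * real ?d) \<le> M * \<rho> powr real ?d"
      unfolding M_def by (simp only: mult_ac)
    then have "real (card A) * \<rho> powr (\<gamma> * real ?d) * \<rho> powr (t - \<gamma> * real ?d)
        \<le> M * \<rho> powr real ?d * \<rho> powr (t - \<gamma> * real ?d)"
      by (rule mult_right_mono) simp
    then have "real (card A) * \<rho> powr t \<le> M * \<rho> powr (real ?d + (t - \<gamma> * real ?d))"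
      using \<rho>(1) by (simp add: mult.assoc flip: powr_add)
    also have "real ?d + (t - \<gamma> * real ?d) = s + (t - s) / 2" unfolding \<gamma>(2) by (simp add: field_simps)
    finally have c: "real (card A) * \<rho> powr t \<le> M * \<rho> powr (s + (t - s) / 2)" .
    have "(\<Sum>u\<in>A. N u powr t) \<le> (\<Sum>u\<in>A. \<rho> powr t)"
      using A N_pos st by (intro sum_mono powr_mono2) (auto intro: less_imp_le)
    also have "\<dots> = real (card A) * \<rho> powr t" by simp
    finally show ?thesis using c by linarith
  qed
  show ?thesis
  proof (rule that[OF M, of "min \<rho>1 1"])
    show "min \<rho>1 1 > 0" using \<rho>1 by simp
  next
    fix \<delta> U assume \<delta>: "0 < \<delta>" "\<delta> < min \<rho>1 1" and U: "admissible_cover (attractor I Jw) \<theta> \<delta> U"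
      and cost: "(\<Sum>\<^sub>\<infinity>X\<in>U. diam_powr s X) \<le> 1"
    have Usub: "attractor I Jw \<subseteq> \<Union>U" using U unfolding admissible_cover_def countable_cover_def by blast
    have UX: "bounded X" "diameter X \<le> \<delta>" "\<delta> powr (1 / \<theta>) \<le> diameter X" if "X \<in> U" for X
      using U \<theta> that unfolding admissible_cover_def countable_cover_def by auto
    have Upos: "0 < diameter X" if "X \<in> U" for X
    proof -
      have "0 < \<delta> powr (1 / \<theta>)" using \<delta>(1) by simp
      then show ?thesis using UX(3)[OF that] by linarith
    qed
    \<comment> \<open>The words whose norm passes the diameter of a member of the cover that their basic set meets.\<close>
    define S where "S = {u. admissible 1 u \<and>
       (\<exists>X\<in>U. N u \<le> diameter X \<and> diameter X < N (butlast u) \<and> Jw u \<inter> X \<noteq> {})}"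
    define A where "A = {u \<in> S. \<forall>n<length u. take n u \<notin> S}"
    have cut: "cut_set I A" unfolding A_def
    proof (rule minimal_words_cut_set)
      show "S \<subseteq> all_words I" by (auto simp: S_def all_words_iff)
    next
      fix v assume v: "v \<in> infinite_words I"
      obtain x where x: "x \<in> attractor I Jw" "\<And>n. x \<in> Jw (initial v n)"
        using attractor_point[OF v] by metis
      obtain X where X: "X \<in> U" "x \<in> X" using x(1) Usub by blast
      have "diameter X < 1" using UX(2)[OF X(1)] \<delta>(2) by simp
      then obtain n where n: "N (initial v n) \<le> diameter X" "diameter X < N (butlast (initial v n))"
        using stopping_word[OF v Upos[OF X(1)]] by blast
      have "Jw (initial v n) \<inter> X \<noteq> {}" using x(2) X(2) by blast
      then have "initial v n \<in> S" unfolding S_def using n X(1) admissible_initial[OF v, of n] by blast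
      then show "\<exists>n. initial v n \<in> S" ..
    qed
    have "\<forall>u\<in>A. \<exists>X\<in>U. N u \<le> diameter X \<and> diameter X < N (butlast u) \<and> Jw u \<inter> X \<noteq> {}"
      unfolding A_def S_def by blast
    then obtain h where h: "\<And>u. u \<in> A \<Longrightarrow> h u \<in> U \<and> N u \<le> diameter (h u) \<and> diameter (h u) < N (butlast u) \<and> Jw u \<inter> h u \<noteq> {}"
      by metis
    have "\<delta> powr (1 / \<theta>) < N (butlast u) \<and> N u \<le> \<delta>" if u: "u \<in> A" for u
      using h[OF u] UX(2,3)[of "h u"] by linarith
    then have Acut: "A \<in> cut_sets I J \<psi> \<delta> \<theta>" using cut by (simp add: cut_sets_def)
    note adm = cut_sets_admissible[OF Acut \<delta>(1)] and fin = cut_sets_finite[OF Acut \<delta>(1)]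
    have part: "(\<Sum>u | u \<in> A \<and> h u = X. N u powr t) \<le> M * \<delta> powr ((t - s) / 2) * diameter X powr s"
      if X: "X \<in> h ` A" for X
    proof -
      have XU: "X \<in> U" using X h by blast
      have "\<exists>x. x \<in> X" using X h by blast
      then obtain x where x: "x \<in> X" ..
      have "(\<Sum>u | u \<in> A \<and> h u = X. N u powr t) \<le> M * diameter X powr (s + (t - s) / 2)"
      proof (rule piece[OF Upos[OF XU] _ _ _ UX(1)[OF XU] refl x])
        show "pairwise branching {u \<in> A. h u = X}"
          by (rule pairwise_subset[OF cut_set_branching[OF cut]]) auto
      qed (use UX(2)[OF XU] \<delta>(2) fin adm h in auto)
      also have "\<dots> = M * (diameter X powr ((t - s) / 2) * diameter X powr s)"
        by (simp add: powr_add mult.commute)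
      also have "\<dots> \<le> M * (\<delta> powr ((t - s) / 2) * diameter X powr s)"
        using M UX(2)[OF XU] Upos[OF XU] st
        by (intro mult_left_mono mult_right_mono powr_mono2) auto
      finally show ?thesis by simp
    qed
    have "ennreal (\<Sum>X\<in>h ` A. diameter X powr s) = (\<Sum>X\<in>h ` A. diam_powr s X)"
    proof -
      have "ennreal (diameter X powr s) = diam_powr s X" if "X \<in> h ` A" for X
      proof -
        have "X \<in> U" using that h by blast
        then have "0 < diameter X" by (rule Upos)
        moreover from this have "X \<noteq> {}" by auto
        ultimately show ?thesis by (simp add: diam_powr_def)
      qed
      then show ?thesis by (subst sum_ennreal[symmetric]) (auto intro!: sum.cong)
    qed
    also have "\<dots> \<le> (\<Sum>\<^sub>\<infinity>X\<in>U. diam_powr s X)"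
      by (rule sum_le_infsum_ennreal) (use fin h in auto)
    also have "\<dots> \<le> ennreal 1" using cost by simp
    finally have tot: "(\<Sum>X\<in>h ` A. diameter X powr s) \<le> 1" by (simp add: ennreal_le_1)
    have "(\<Sum>u\<in>A. N u powr t) = (\<Sum>X\<in>h ` A. \<Sum>u | u \<in> A \<and> h u = X. N u powr t)"
      by (rule sum.image_gen[OF fin])
    also have "\<dots> \<le> (\<Sum>X\<in>h ` A. M * \<delta> powr ((t - s) / 2) * diameter X powr s)"
      by (rule sum_mono) (rule part)
    also have "\<dots> = M * \<delta> powr ((t - s) / 2) * (\<Sum>X\<in>h ` A. diameter X powr s)"
      by (simp add: sum_distrib_left)
    also have "\<dots> \<le> M * \<delta> powr ((t - s) / 2) * 1"
      using tot M by (intro mult_left_mono) auto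
    finally show "\<exists>A\<in>cut_sets I J \<psi> \<delta> \<theta>. (\<Sum>u\<in>A. N u powr t) \<le> M * \<delta> powr ((t - s) / 2)"
      using Acut by auto
  qed
qed

section \<open>The critical exponents are the intermediate dimensions\<close>

text \<open>The volume estimate bounds the sum with exponent \<open>DIM('a)\<close> over every cut set; one more power of
  the norms gives a factor \<open>\<delta>\<close>.  This shows that the critical exponents are infima of nonempty sets.\<close>

lemma upper_pressure_neg_dim:
  assumes \<theta>: "0 < \<theta>" "\<theta> \<le> 1"
  shows "upper_pressure I J \<psi> (real DIM('a) + 1) \<theta> < 0"
proof -
  obtain \<kappa> where \<kappa>: "\<kappa> > 0" "\<And>A x R. finite A \<Longrightarrow> R \<ge> 0 \<Longrightarrow> (\<And>u. u \<in> A \<Longrightarrow> admissible 1 u) \<Longrightarrow>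
     pairwise branching A \<Longrightarrow> (\<And>u. u \<in> A \<Longrightarrow> Jw u \<subseteq> cball x R) \<Longrightarrow>
     (\<Sum>u\<in>A. N u ^ DIM('a)) \<le> (R / \<kappa>) ^ DIM('a)"
    using sum_norm_power_le by metis
  obtain R where R: "R > 0" "J \<subseteq> cball 0 R"
    using bounded_subset_ballD[OF compact_imp_bounded[OF compact_J], of 0] ball_subset_cball
    by (metis subset_trans)
  define M where "M = (R / \<kappa>) ^ DIM('a)"
  have M: "M > 0" using R \<kappa> by (simp add: M_def)
  obtain \<zeta> \<delta>0 where p: "\<zeta> > 0" "\<delta>0 > 0"
    "\<And>\<delta> A \<theta> t. 0 < \<delta> \<Longrightarrow> \<delta> < \<delta>0 \<Longrightarrow> A \<in> cut_sets I J \<psi> \<delta> \<theta> \<Longrightarrow>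
       (\<Sum>u\<in>A. N u powr t) \<le> M * \<delta> powr 1 \<Longrightarrow> pressure_term I J \<psi> t \<theta> \<delta> \<le> - \<zeta>"
    using pressure_term_le[of 1 M] M by auto
  have "pressure_term I J \<psi> (real DIM('a) + 1) \<theta> \<delta> \<le> - \<zeta>"
    if \<delta>: "0 < \<delta>" "\<delta> < min \<delta>0 1" for \<delta>
  proof -
    have \<delta>1: "\<delta> < 1" using \<delta> by simp
    obtain A where A: "cut_set I A" "\<And>u. u \<in> A \<Longrightarrow> N u \<le> \<delta> \<and> \<delta> < N (butlast u)"
      using stopping_cut_set[OF \<delta>(1) \<delta>1] by blast
    have Acut: "A \<in> cut_sets I J \<psi> \<delta> \<theta>" by (rule stopping_in_cut_sets[OF \<delta>(1) \<delta>1 \<theta> A])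
    note adm = cut_sets_admissible[OF Acut \<delta>(1)] and fin = cut_sets_finite[OF Acut \<delta>(1)]
    have sub: "Jw u \<subseteq> cball 0 R" if "u \<in> A" for u
    proof -
      have "\<forall>u\<in>all_words I. closed (Jw u) \<and> Jw u \<subseteq> J" using ifs by (simp add: nonautonomous_ifs_def)
      then show ?thesis using adm[OF that] all_words_iff R(2) by blast
    qed
    have "(\<Sum>u\<in>A. N u powr (real DIM('a) + 1)) \<le> (\<Sum>u\<in>A. \<delta> * N u ^ DIM('a))"
    proof (rule sum_mono)
      fix u assume u: "u \<in> A"
      have Nu: "0 < N u" using N_pos[OF adm[OF u]] .
      have "N u powr (real DIM('a) + 1) = N u * N u ^ DIM('a)"
        using Nu by (simp add: powr_add powr_realpow)
      also have "\<dots> \<le> \<delta> * N u ^ DIM('a)"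
        using A(2)[OF u] Nu by (intro mult_right_mono) auto
      finally show "N u powr (real DIM('a) + 1) \<le> \<delta> * N u ^ DIM('a)" .
    qed
    also have "\<dots> = \<delta> * (\<Sum>u\<in>A. N u ^ DIM('a))" by (simp add: sum_distrib_left)
    also have "\<dots> \<le> \<delta> * M"
      unfolding M_def
      by (rule mult_left_mono[OF \<kappa>(2)[OF fin _ adm cut_set_branching[OF A(1)] sub]])
        (use R \<delta> in auto)
    also have "\<dots> = M * \<delta> powr 1" using \<delta>(1) by simp
    finally show ?thesis using p(3)[OF \<delta>(1) _ Acut] \<delta>(2) by simp
  qed
  then have "\<forall>\<^sub>F \<delta> in at_right 0. pressure_term I J \<psi> (real DIM('a) + 1) \<theta> \<delta> \<le> - \<zeta>"
    unfolding eventually_at_right_field using p(2) by (intro exI[of _ "min \<delta>0 1"]) auto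
  then show ?thesis by (rule upper_pressure_negI[OF p(1)])
qed

lemma lower_pressure_le_upper: "lower_pressure I J \<psi> t \<theta> \<le> upper_pressure I J \<psi> t \<theta>"
  unfolding lower_pressure_def upper_pressure_def by (rule Liminf_le_Limsup) simp

lemma lower_pressure_neg_imp_pos:
  assumes \<theta>: "0 < \<theta>" "\<theta> \<le> 1" and neg: "lower_pressure I J \<psi> t \<theta> < 0"
  shows "0 < t"
proof (rule ccontr)
  assume "\<not> 0 < t"
  then have "0 \<le> pressure_term I J \<psi> t \<theta> \<delta>" if "0 < \<delta>" "\<delta> < 1" for \<delta>
    using pressure_term_nonneg[OF _ \<theta> that] by simp
  then have "\<forall>\<^sub>F \<delta> in at_right 0. 0 \<le> ereal (pressure_term I J \<psi> t \<theta> \<delta>)"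
    unfolding eventually_at_right_field by (intro exI[of _ 1]) auto
  then have "0 \<le> lower_pressure I J \<psi> t \<theta>" unfolding lower_pressure_def by (rule Liminf_bounded)
  then show False using neg by simp
qed

abbreviation cheap_cover :: "real \<Rightarrow> real \<Rightarrow> real \<Rightarrow> real \<Rightarrow> bool" where
  "cheap_cover \<theta> s \<epsilon> \<delta> \<equiv> (\<exists>U. admissible_cover (attractor I Jw) \<theta> \<delta> U \<and>
     (\<Sum>\<^sub>\<infinity>X\<in>U. diam_powr s X) \<le> ennreal \<epsilon>)"

text \<open>The factor \<open>L\<close> is chosen before the bound \<open>\<epsilon>\<close> on the cost, as the change of scale must not depend
  on \<open>\<epsilon>\<close>.  The cost tends to 0 since it is at most a constant times \<open>exp (- \<zeta> * k_delta)\<close> and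
  \<open>k_delta\<close> tends to infinity.\<close>

lemma eventually_cheap_cover:
  assumes lim: "(\<lambda>k. ln (min_ratio I J \<psi> k) / ln (max_norm I J \<psi> k)) \<longlonglongrightarrow> 0"
    and \<theta>: "0 < \<theta>" "\<theta> \<le> 1" and st: "0 < t" "t < s" and \<zeta>: "\<zeta> > 0"
  obtains L where "L > 0" "\<And>\<epsilon>. \<epsilon> > 0 \<Longrightarrow> \<forall>\<^sub>F \<delta> in at_right 0.
     pressure_term I J \<psi> t \<theta> \<delta> < - \<zeta> \<longrightarrow> cheap_cover \<theta> s \<epsilon> (L * \<delta>)"
proof -
  obtain L B \<delta>0 where L: "L > 0" "B > 0" "\<delta>0 > 0"
    "\<And>\<delta> A. 0 < \<delta> \<Longrightarrow> \<delta> < \<delta>0 \<Longrightarrow> A \<in> cut_sets I J \<psi> \<delta> \<theta> \<Longrightarrow>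
       \<exists>U. admissible_cover (attractor I Jw) \<theta> (L * \<delta>) U \<and>
         (\<Sum>\<^sub>\<infinity>X\<in>U. diam_powr s X) \<le> ennreal (B * (\<Sum>u\<in>A. N u powr t))"
    using cover_of_cut_set[OF lim \<theta> st] by metis
  show ?thesis
  proof (rule that[OF L(1)])
    fix \<epsilon> :: real assume \<epsilon>: "\<epsilon> > 0"
    have "exp (- \<zeta>) < 1" using \<zeta> by simp
    then obtain n where "exp (- \<zeta>) ^ n < \<epsilon> / B"
      using real_arch_pow_inv[of "\<epsilon> / B" "exp (- \<zeta>)"] \<epsilon> L(2) by auto
    then have n: "exp (- \<zeta> * real n) < \<epsilon> / B"
      by (simp add: exp_of_nat_mult[symmetric] mult.commute)
    have ev1: "\<forall>\<^sub>F \<delta> in at_right 0. n \<le> k_delta I J \<psi> \<delta>"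
      using k_delta_at_top unfolding filterlim_at_top by blast
    have ev2: "\<forall>\<^sub>F \<delta> in at_right 0. 0 < \<delta> \<and> \<delta> < min \<delta>0 1"
      unfolding eventually_at_right_field using L(3) by (intro exI[of _ "min \<delta>0 1"]) auto
    show "\<forall>\<^sub>F \<delta> in at_right 0. pressure_term I J \<psi> t \<theta> \<delta> < - \<zeta> \<longrightarrow> cheap_cover \<theta> s \<epsilon> (L * \<delta>)"
      using ev1 ev2
    proof eventually_elim
      case (elim \<delta>)
      show ?case
      proof
        assume p: "pressure_term I J \<psi> t \<theta> \<delta> < - \<zeta>"
        have \<delta>: "0 < \<delta>" "\<delta> < 1" "\<delta> < \<delta>0" using elim by auto
        obtain A where A: "A \<in> cut_sets I J \<psi> \<delta> \<theta>"
          "(\<Sum>u\<in>A. N u powr t) < exp (- \<zeta> * real (k_delta I J \<psi> \<delta>))"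
          using sum_lt_of_pressure_term[OF p \<zeta> \<theta> \<delta>(1,2)] .
        have "- \<zeta> * real (k_delta I J \<psi> \<delta>) \<le> - \<zeta> * real n" using elim(1) \<zeta> by simp
        then have "exp (- \<zeta> * real (k_delta I J \<psi> \<delta>)) \<le> exp (- \<zeta> * real n)" by (simp only: exp_le_cancel_iff)
        then have "(\<Sum>u\<in>A. N u powr t) < \<epsilon> / B" using A(2) n by linarith
        then have "B * (\<Sum>u\<in>A. N u powr t) \<le> \<epsilon>" using L(2) by (simp add: field_simps)
        then have "ennreal (B * (\<Sum>u\<in>A. N u powr t)) \<le> ennreal \<epsilon>" by (rule ennreal_leI)
        then show "cheap_cover \<theta> s \<epsilon> (L * \<delta>)" using L(4)[OF \<delta>(1,3) A(1)] order_trans by blast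
      qed
    qed
  qed
qed

lemma eventually_pressure_neg:
  assumes lim: "(\<lambda>k. ln (min_ratio I J \<psi> k) / ln (max_norm I J \<psi> k)) \<longlonglongrightarrow> 0"
    and \<theta>: "0 < \<theta>" "\<theta> \<le> 1" and st: "0 \<le> s" "s < t"
  obtains \<zeta> where "\<zeta> > 0"
    "\<forall>\<^sub>F \<delta> in at_right 0. cheap_cover \<theta> s 1 \<delta> \<longrightarrow> pressure_term I J \<psi> t \<theta> \<delta> \<le> - \<zeta>"
proof -
  obtain M \<delta>0 where M: "M > 0" "\<delta>0 > 0"
    "\<And>\<delta> U. 0 < \<delta> \<Longrightarrow> \<delta> < \<delta>0 \<Longrightarrow> admissible_cover (attractor I Jw) \<theta> \<delta> U \<Longrightarrow>
       (\<Sum>\<^sub>\<infinity>X\<in>U. diam_powr s X) \<le> 1 \<Longrightarrow>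
       \<exists>A\<in>cut_sets I J \<psi> \<delta> \<theta>. (\<Sum>u\<in>A. N u powr t) \<le> M * \<delta> powr ((t - s) / 2)"
    using cut_set_of_cover[OF lim \<theta> st] by metis
  have "(t - s) / 2 > 0" using st by simp
  then obtain \<zeta> \<delta>1 where p: "\<zeta> > 0" "\<delta>1 > 0"
    "\<And>\<delta> A \<theta> r. 0 < \<delta> \<Longrightarrow> \<delta> < \<delta>1 \<Longrightarrow> A \<in> cut_sets I J \<psi> \<delta> \<theta> \<Longrightarrow>
       (\<Sum>u\<in>A. N u powr r) \<le> M * \<delta> powr ((t - s) / 2) \<Longrightarrow> pressure_term I J \<psi> r \<theta> \<delta> \<le> - \<zeta>"
    using pressure_term_le[OF _ M(1)] by metis
  have "\<forall>\<^sub>F \<delta> in at_right 0. cheap_cover \<theta> s 1 \<delta> \<longrightarrow> pressure_term I J \<psi> t \<theta> \<delta> \<le> - \<zeta>"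
    unfolding eventually_at_right_field
  proof (intro exI[of _ "min \<delta>0 \<delta>1"] conjI allI impI)
    fix \<delta> assume \<delta>: "0 < \<delta>" "\<delta> < min \<delta>0 \<delta>1" and "cheap_cover \<theta> s 1 \<delta>"
    then obtain U where U: "admissible_cover (attractor I Jw) \<theta> \<delta> U" "(\<Sum>\<^sub>\<infinity>X\<in>U. diam_powr s X) \<le> 1"
      by auto
    have \<delta>': "\<delta> < \<delta>0" "\<delta> < \<delta>1" using \<delta>(2) by auto
    show "pressure_term I J \<psi> t \<theta> \<delta> \<le> - \<zeta>"
      using M(3)[OF \<delta>(1) \<delta>'(1) U] p(3)[OF \<delta>(1) \<delta>'(2)] by blast
  qed (use M p in auto)
  then show ?thesis using that p(1) by blast
qed

lemma upper_intermediate_dim_eq: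
  assumes lim: "(\<lambda>k. ln (min_ratio I J \<psi> k) / ln (max_norm I J \<psi> k)) \<longlonglongrightarrow> 0"
    and \<theta>: "0 < \<theta>" "\<theta> \<le> 1"
  shows "upper_intermediate_dim \<theta> (attractor I Jw) = Inf {t. upper_pressure I J \<psi> t \<theta> < 0}"
  unfolding upper_intermediate_dim_def
proof (rule Inf_eq_of_interlacing)
  fix t assume "t \<in> {t. upper_pressure I J \<psi> t \<theta> < 0}"
  then have "lower_pressure I J \<psi> t \<theta> < 0"
    using lower_pressure_le_upper[of t \<theta>] by (metis mem_Collect_eq order_le_less_trans)
  then show "0 < t" by (rule lower_pressure_neg_imp_pos[OF \<theta>])
next
  show "{t. upper_pressure I J \<psi> t \<theta> < 0} \<noteq> {}" using upper_pressure_neg_dim[OF \<theta>] by blast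
next
  fix s t assume "t \<in> {t. upper_pressure I J \<psi> t \<theta> < 0}" and st: "t < s"
  then have neg: "upper_pressure I J \<psi> t \<theta> < 0" by simp
  then have "lower_pressure I J \<psi> t \<theta> < 0"
    using lower_pressure_le_upper[of t \<theta>] by (metis order_le_less_trans)
  then have t: "0 < t" by (rule lower_pressure_neg_imp_pos[OF \<theta>])
  obtain \<zeta> where \<zeta>: "\<zeta> > 0" "\<forall>\<^sub>F \<delta> in at_right 0. pressure_term I J \<psi> t \<theta> \<delta> < - \<zeta>"
    using upper_pressure_negD[OF neg] .
  obtain L where L: "L > 0" "\<And>\<epsilon>. \<epsilon> > 0 \<Longrightarrow> \<forall>\<^sub>F \<delta> in at_right 0.
     pressure_term I J \<psi> t \<theta> \<delta> < - \<zeta> \<longrightarrow> cheap_cover \<theta> s \<epsilon> (L * \<delta>)"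
    using eventually_cheap_cover[OF lim \<theta> t st \<zeta>(1)] by blast
  have "\<exists>\<Delta>>0. \<forall>\<delta>. 0 < \<delta> \<and> \<delta> \<le> \<Delta> \<longrightarrow> cheap_cover \<theta> s \<epsilon> \<delta>" if "\<epsilon> > 0" for \<epsilon>
  proof -
    have "\<forall>\<^sub>F \<delta> in at_right 0. cheap_cover \<theta> s \<epsilon> (L * \<delta>)"
      using \<zeta>(2) L(2)[OF that] by eventually_elim blast
    then obtain b where b: "b > 0" "\<And>\<delta>. 0 < \<delta> \<Longrightarrow> \<delta> < b \<Longrightarrow> cheap_cover \<theta> s \<epsilon> (L * \<delta>)"
      unfolding eventually_at_right_field by blast
    show ?thesis
    proof (intro exI[of _ "L * b / 2"] conjI allI impI)
      show "0 < L * b / 2" using L(1) b(1) by simp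
      fix \<delta> assume \<delta>: "0 < \<delta> \<and> \<delta> \<le> L * b / 2"
      then have "\<delta> / L \<le> b / 2" using L(1) by (simp add: field_simps)
      then have "\<delta> / L < b" using b(1) by linarith
      then show "cheap_cover \<theta> s \<epsilon> \<delta>" using b(2)[of "\<delta> / L"] \<delta> L(1) by simp
    qed
  qed
  then show "s \<in> {s. 0 \<le> s \<and> (\<forall>\<epsilon>>0. \<exists>\<Delta>>0. \<forall>\<delta>. 0 < \<delta> \<and> \<delta> \<le> \<Delta> \<longrightarrow> cheap_cover \<theta> s \<epsilon> \<delta>)}"
    using t st by simp
next
  fix s t assume "s \<in> {s. 0 \<le> s \<and> (\<forall>\<epsilon>>0. \<exists>\<Delta>>0. \<forall>\<delta>. 0 < \<delta> \<and> \<delta> \<le> \<Delta> \<longrightarrow> cheap_cover \<theta> s \<epsilon> \<delta>)}"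
    and st: "s < t"
  then have s: "0 \<le> s" and D: "\<forall>\<epsilon>>0. \<exists>\<Delta>>0. \<forall>\<delta>. 0 < \<delta> \<and> \<delta> \<le> \<Delta> \<longrightarrow> cheap_cover \<theta> s \<epsilon> \<delta>"
    by simp_all
  obtain \<Delta> where \<Delta>: "\<Delta> > 0" "\<And>\<delta>. 0 < \<delta> \<and> \<delta> \<le> \<Delta> \<Longrightarrow> cheap_cover \<theta> s 1 \<delta>"
    using D[rule_format, of 1] by auto
  obtain \<zeta> where \<zeta>: "\<zeta> > 0"
    "\<forall>\<^sub>F \<delta> in at_right 0. cheap_cover \<theta> s 1 \<delta> \<longrightarrow> pressure_term I J \<psi> t \<theta> \<delta> \<le> - \<zeta>"
    using eventually_pressure_neg[OF lim \<theta> s st] .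
  have "\<forall>\<^sub>F \<delta> in at_right 0. cheap_cover \<theta> s 1 \<delta>"
    unfolding eventually_at_right_field using \<Delta> by (intro exI[of _ \<Delta>]) auto
  then have "\<forall>\<^sub>F \<delta> in at_right 0. pressure_term I J \<psi> t \<theta> \<delta> \<le> - \<zeta>"
    using \<zeta>(2) by eventually_elim blast
  then show "t \<in> {t. upper_pressure I J \<psi> t \<theta> < 0}" using upper_pressure_negI[OF \<zeta>(1)] by simp
qed simp

lemma lower_intermediate_dim_eq:
  assumes lim: "(\<lambda>k. ln (min_ratio I J \<psi> k) / ln (max_norm I J \<psi> k)) \<longlonglongrightarrow> 0"
    and \<theta>: "0 < \<theta>" "\<theta> \<le> 1"
  shows "lower_intermediate_dim \<theta> (attractor I Jw) = Inf {t. lower_pressure I J \<psi> t \<theta> < 0}"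
  unfolding lower_intermediate_dim_def
proof (rule Inf_eq_of_interlacing)
  fix t assume "t \<in> {t. lower_pressure I J \<psi> t \<theta> < 0}"
  then show "0 < t" using lower_pressure_neg_imp_pos[OF \<theta>] by simp
next
  have "lower_pressure I J \<psi> (real DIM('a) + 1) \<theta> < 0"
    using lower_pressure_le_upper upper_pressure_neg_dim[OF \<theta>] by (rule order_le_less_trans)
  then show "{t. lower_pressure I J \<psi> t \<theta> < 0} \<noteq> {}" by blast
next
  fix s t assume "t \<in> {t. lower_pressure I J \<psi> t \<theta> < 0}" and st: "t < s"
  then have neg: "lower_pressure I J \<psi> t \<theta> < 0" by simp
  then have t: "0 < t" by (rule lower_pressure_neg_imp_pos[OF \<theta>])
  obtain \<zeta> where \<zeta>: "\<zeta> > 0" "\<exists>\<^sub>F \<delta> in at_right 0. pressure_term I J \<psi> t \<theta> \<delta> < - \<zeta>"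
    using lower_pressure_negD[OF neg] .
  obtain L where L: "L > 0" "\<And>\<epsilon>. \<epsilon> > 0 \<Longrightarrow> \<forall>\<^sub>F \<delta> in at_right 0.
     pressure_term I J \<psi> t \<theta> \<delta> < - \<zeta> \<longrightarrow> cheap_cover \<theta> s \<epsilon> (L * \<delta>)"
    using eventually_cheap_cover[OF lim \<theta> t st \<zeta>(1)] by blast
  have "\<exists>\<delta>. 0 < \<delta> \<and> \<delta> \<le> \<Delta> \<and> cheap_cover \<theta> s \<epsilon> \<delta>" if "\<epsilon> > 0" and \<Delta>: "\<Delta> > 0" for \<epsilon> \<Delta>
  proof -
    have "\<forall>\<^sub>F \<delta> in at_right 0. 0 < \<delta> \<and> \<delta> < \<Delta> / L"
      unfolding eventually_at_right_field using L(1) \<Delta> by (intro exI[of _ "\<Delta> / L"]) auto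
    then have ev: "\<forall>\<^sub>F \<delta> in at_right 0. pressure_term I J \<psi> t \<theta> \<delta> < - \<zeta> \<longrightarrow>
        0 < \<delta> \<and> \<delta> < \<Delta> / L \<and> cheap_cover \<theta> s \<epsilon> (L * \<delta>)"
      using L(2)[OF \<open>\<epsilon> > 0\<close>] by eventually_elim blast
    obtain \<delta> where \<delta>: "0 < \<delta>" "\<delta> < \<Delta> / L" "cheap_cover \<theta> s \<epsilon> (L * \<delta>)"
      using frequently_ex[OF frequently_mp[OF ev \<zeta>(2)]] by blast
    have "0 < L * \<delta>" "L * \<delta> \<le> \<Delta>" using \<delta>(1,2) L(1) by (simp_all add: field_simps)
    then show ?thesis using \<delta>(3) by blast
  qed
  then show "s \<in> {s. 0 \<le> s \<and> (\<forall>\<epsilon>>0. \<forall>\<Delta>>0. \<exists>\<delta>. 0 < \<delta> \<and> \<delta> \<le> \<Delta> \<and> cheap_cover \<theta> s \<epsilon> \<delta>)}"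
    using t st by simp
next
  fix s t assume "s \<in> {s. 0 \<le> s \<and> (\<forall>\<epsilon>>0. \<forall>\<Delta>>0. \<exists>\<delta>. 0 < \<delta> \<and> \<delta> \<le> \<Delta> \<and> cheap_cover \<theta> s \<epsilon> \<delta>)}"
    and st: "s < t"
  then have s: "0 \<le> s" and D: "\<forall>\<epsilon>>0. \<forall>\<Delta>>0. \<exists>\<delta>. 0 < \<delta> \<and> \<delta> \<le> \<Delta> \<and> cheap_cover \<theta> s \<epsilon> \<delta>"
    by simp_all
  obtain \<zeta> where \<zeta>: "\<zeta> > 0"
    "\<forall>\<^sub>F \<delta> in at_right 0. cheap_cover \<theta> s 1 \<delta> \<longrightarrow> pressure_term I J \<psi> t \<theta> \<delta> \<le> - \<zeta>"
    using eventually_pressure_neg[OF lim \<theta> s st] .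
  have "\<exists>\<^sub>F \<delta> in at_right 0. cheap_cover \<theta> s 1 \<delta>"
    unfolding frequently_def
  proof
    assume "\<forall>\<^sub>F \<delta> in at_right 0. \<not> cheap_cover \<theta> s 1 \<delta>"
    then obtain b where b: "b > 0" "\<And>\<delta>. 0 < \<delta> \<Longrightarrow> \<delta> < b \<Longrightarrow> \<not> cheap_cover \<theta> s 1 \<delta>"
      unfolding eventually_at_right_field by blast
    obtain \<delta> where "0 < \<delta>" "\<delta> \<le> b / 2" "cheap_cover \<theta> s 1 \<delta>"
      using D[rule_format, of 1 "b / 2"] b(1) by auto
    then show False using b by force
  qed
  then have "\<exists>\<^sub>F \<delta> in at_right 0. pressure_term I J \<psi> t \<theta> \<delta> \<le> - \<zeta>"
    by (rule frequently_mp[OF \<zeta>(2)])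
  then show "t \<in> {t. lower_pressure I J \<psi> t \<theta> < 0}" using lower_pressure_negI[OF \<zeta>(1)] by simp
qed simp

end

theorem theorem2p1:
  fixes I :: "nat \<Rightarrow> 'i set"
    and J V :: "'a::euclidean_space set"
    and \<phi> \<psi> :: "nat \<Rightarrow> 'i \<Rightarrow> 'a \<Rightarrow> 'a"
    and Jw :: "'i list \<Rightarrow> 'a set"
    and \<theta> :: real
  assumes "nonautonomous_ifs I J \<phi> Jw"
    and "conformal_extension I J \<phi> V \<psi>"
    and "open_set_condition I Jw"
    and "(\<lambda>k. ln (min_ratio I J \<psi> k) / ln (max_norm I J \<psi> k)) \<longlonglongrightarrow> 0"
    and "0 \<le> \<theta>" and "\<theta> \<le> 1"
  shows "upper_intermediate_dim \<theta> (attractor I Jw) = upper_exponent I J \<psi> Jw \<theta> \<and>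
         lower_intermediate_dim \<theta> (attractor I Jw) = lower_exponent I J \<psi> Jw \<theta>"
proof (cases "\<theta> = 0")
  case True
  then show ?thesis
    by (simp add: upper_exponent_def lower_exponent_def intermediate_dim_0)
next
  case False
  interpret conformal_ifs I J V \<phi> \<psi> Jw
    by unfold_locales (rule assms(1-3))+
  have "0 < \<theta>" using False assms(5) by simp
  then show ?thesis
    using upper_intermediate_dim_eq[OF assms(4) _ assms(6)]
      lower_intermediate_dim_eq[OF assms(4) _ assms(6)] False
    by (simp add: upper_exponent_def lower_exponent_def)
qed

end
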